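(* Let $n \leq 6$ be a positive integer. Every synchronizing DFA on $n$ states admits a synchronizing word of length at most $(n-1)^2$.
   Context: A deterministic finite automaton (DFA) over a finite alphabet $\Sigma$ consists of a finite set $Q$ of states and a (total) map $\delta : Q \times \Sigma \to Q$ (initial and final states are ignored). There is no restriction on the size of $\Sigma$. For $q\in Q$, $w \in \Sigma^*$, $a\in\Sigma$ define $q\lambda = q$ for the empty word $\lambda$, and $q(wa) = \delta(qw,a)$. A word $w\in\Sigma^*$ is synchronizing if there is a state $q_s \in Q$ with $qw = q_s$ for all $q \in Q$. A DFA is synchronizing if it admits a synchronizing word. *)

theory Defs
  imports Main
begin

locale dfa =
  fixes \<Sigma> :: "'a set" and Q :: "'q set" and \<delta> :: "'q \<Rightarrow> 'a \<Rightarrow> 'q"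
  assumes finite_alphabet: "finite \<Sigma>"
    and finite_states: "finite Q"
    and step_closed: "q \<in> Q \<Longrightarrow> a \<in> \<Sigma> \<Longrightarrow> \<delta> q a \<in> Q"

(* Letters are read from the left, so run \<delta> q (w @ [a]) = \<delta> (run \<delta> q w) a. *)
definition run :: "('q \<Rightarrow> 'a \<Rightarrow> 'q) \<Rightarrow> 'q \<Rightarrow> 'a list \<Rightarrow> 'q" where
  "run \<delta> q w = foldl \<delta> q w"

definition synchronizing_word ::
    "'a set \<Rightarrow> 'q set \<Rightarrow> ('q \<Rightarrow> 'a \<Rightarrow> 'q) \<Rightarrow> 'a list \<Rightarrow> bool" where
  "synchronizing_word \<Sigma> Q \<delta> w \<longleftrightarrow>
     w \<in> lists \<Sigma> \<and> (\<exists>s\<in>Q. \<forall>q\<in>Q. run \<delta> q w = s)"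

definition synchronizing_dfa :: "'a set \<Rightarrow> 'q set \<Rightarrow> ('q \<Rightarrow> 'a \<Rightarrow> 'q) \<Rightarrow> bool" where
  "synchronizing_dfa \<Sigma> Q \<delta> \<longleftrightarrow> dfa \<Sigma> Q \<delta> \<and> (\<exists>w. synchronizing_word \<Sigma> Q \<delta> w)"

end

theory Submission
  imports Defs
begin

text \<open>
  Suppose that an automaton with \<open>n\<close> states has reset words, but none of length at most
  \<open>(n - 1)\<^sup>2\<close>. Let \<open>d x y\<close> be the length of a shortest word merging \<open>x\<close> and \<open>y\<close>. A letter lowers
  \<open>d\<close> by at most one, and every pair of distinct states has a letter lowering it by exactly one.
  These two properties, together with the absence of a short reset word over the letters, are all
  that is used of the automaton (\<open>cex\<close>, \<open>automaton_cex\<close>).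

  Let \<open>D k\<close> be the maximum, over all \<open>k\<close>-element sets of states, of the least distance inside the
  set. Merging a closest pair again and again gives a reset word of length at most
  \<open>D 2 + \<dots> + D n\<close> (\<open>greedy_collapse\<close>). If every \<open>k\<close>-set whose distances all exceed \<open>t\<close> belongs
  to a family \<open>A\<close>, then \<open>D k \<le> t + card A\<close>: the letter that brings the closest pair of such a
  set nearer maps the set injectively to another \<open>k\<close>-set with least distance one smaller, so each of the
  values \<open>t + 1, \<dots>, D k\<close> is the least distance of its own member of \<open>A\<close>
  (\<open>pigeonhole_cap\<close>). Hence, in a counterexample, many sets must avoid all close pairs, and this
  leaves few possibilities for the levels \<open>{p. dist d p = t}\<close>.

  The levels are enumerated in the order \<open>t = 1, 2, \<dots>\<close>. Given the lower levels, each condition on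
  a letter concerns that letter alone: it sends no pair of distance above \<open>t\<close> into the level
  \<open>t - 1\<close>. So one pool of all admissible
  maps replaces the unknown alphabet. A pair that no map of the pool sends into level \<open>t - 1\<close> is not in
  level \<open>t\<close>; a branch dies when the caps on \<open>D 2, \<dots>, D n\<close> add up to at most \<open>(n - 1)\<^sup>2\<close>, or
  when a pair of a known level has lost all its witnesses in the pool. Once a pair has been tried as a member
  of the level, its whole orbit under transpositions of states that preserve the partial layering may be excluded
  from the level, because renaming the states of a counterexample gives a counterexample (\<open>layer_sound\<close>).

  When all pairs have a level, the search chooses a witness from the pool for one pair after the other,
  and in every case the chosen maps alone admit a reset word of length at most \<open>(n - 1)\<^sup>2\<close>
  (\<open>assign_sound\<close>). So no counterexample exists for \<open>2 \<le> n \<le> 6\<close>.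
\<close>

section \<open>States, pairs and maps as data\<close>

text \<open>Six labels serve all automata with at most six states; fewer states use an initial segment of the
  labels. Sets, relations and maps have one slot per label, so that a lookup is a single rewrite
  step.\<close>
datatype state = S0 | S1 | S2 | S3 | S4 | S5

datatype row = Row bool bool bool bool bool bool

datatype table = Table row row row row row row

datatype trans = Trans state state state state state state

type_synonym pair = "state \<times> state"

fun bit :: "state \<Rightarrow> row \<Rightarrow> bool" where
  "bit S0 (Row a b c d e f) = a"
|   "bit S1 (Row a b c d e f) = b"
|   "bit S2 (Row a b c d e f) = c"
|   "bit S3 (Row a b c d e f) = d"
|   "bit S4 (Row a b c d e f) = e"
|   "bit S5 (Row a b c d e f) = f"

fun line :: "state \<Rightarrow> table \<Rightarrow> row" where
  "line S0 (Table a b c d e f) = a"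
|   "line S1 (Table a b c d e f) = b"
|   "line S2 (Table a b c d e f) = c"
|   "line S3 (Table a b c d e f) = d"
|   "line S4 (Table a b c d e f) = e"
|   "line S5 (Table a b c d e f) = f"

fun img :: "state \<Rightarrow> trans \<Rightarrow> state" where
  "img S0 (Trans a b c d e f) = a"
|   "img S1 (Trans a b c d e f) = b"
|   "img S2 (Trans a b c d e f) = c"
|   "img S3 (Trans a b c d e f) = d"
|   "img S4 (Trans a b c d e f) = e"
|   "img S5 (Trans a b c d e f) = f"

fun set_bit :: "state \<Rightarrow> bool \<Rightarrow> row \<Rightarrow> row" where
  "set_bit S0 z (Row a b c d e f) = Row z b c d e f"
|   "set_bit S1 z (Row a b c d e f) = Row a z c d e f"
|   "set_bit S2 z (Row a b c d e f) = Row a b z d e f"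
|   "set_bit S3 z (Row a b c d e f) = Row a b c z e f"
|   "set_bit S4 z (Row a b c d e f) = Row a b c d z f"
|   "set_bit S5 z (Row a b c d e f) = Row a b c d e z"

fun set_row :: "state \<Rightarrow> row \<Rightarrow> table \<Rightarrow> table" where
  "set_row S0 z (Table a b c d e f) = Table z b c d e f"
|   "set_row S1 z (Table a b c d e f) = Table a z c d e f"
|   "set_row S2 z (Table a b c d e f) = Table a b z d e f"
|   "set_row S3 z (Table a b c d e f) = Table a b c z e f"
|   "set_row S4 z (Table a b c d e f) = Table a b c d z f"
|   "set_row S5 z (Table a b c d e f) = Table a b c d e z"

fun set_img :: "state \<Rightarrow> state \<Rightarrow> trans \<Rightarrow> trans" where
  "set_img S0 z (Trans a b c d e f) = Trans z b c d e f"
|   "set_img S1 z (Trans a b c d e f) = Trans a z c d e f"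
|   "set_img S2 z (Trans a b c d e f) = Trans a b z d e f"
|   "set_img S3 z (Trans a b c d e f) = Trans a b c z e f"
|   "set_img S4 z (Trans a b c d e f) = Trans a b c d z f"
|   "set_img S5 z (Trans a b c d e f) = Trans a b c d e z"

definition entry :: "table \<Rightarrow> state \<Rightarrow> state \<Rightarrow> bool" where
  "entry T x y = bit y (line x T)"

text \<open>With \<open>T\<close> the table of the level \<open>t - 1\<close>, this says that \<open>m\<close> lowers the distance of a pair of
  level \<open>t\<close>.\<close>
definition hits :: "table \<Rightarrow> pair \<Rightarrow> trans \<Rightarrow> bool" where
  "hits T p m = entry T (img (fst p) m) (img (snd p) m)"

definition no_row :: row where "no_row = Row False False False False False False"

definition no_table :: table where "no_table = Table no_row no_row no_row no_row no_row no_row"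

definition diagonal :: table where
  "diagonal = Table (Row True False False False False False) (Row False True False False False False)
    (Row False False True False False False) (Row False False False True False False)
    (Row False False False False True False) (Row False False False False False True)"

definition set_entry :: "state \<Rightarrow> state \<Rightarrow> table \<Rightarrow> table" where
  "set_entry x y T = set_row x (set_bit y True (line x T)) T"

fun set_pairs :: "pair list \<Rightarrow> table \<Rightarrow> table" where
  "set_pairs [] T = T"
| "set_pairs ((x, y) # ps) T = set_pairs ps (set_entry x y (set_entry y x T))"

section \<open>Pools of candidate letters\<close>

text \<open>A pool is a set of maps that contains all letters of a counterexample. No map is excluded as long as
  level one is not known. Later pools are trees with short lists at the leaves, which are
  cheaper to rewrite than one long list.\<close>
datatype pool = All | Few "trans list" | Br pool pool

fun br :: "pool \<Rightarrow> pool \<Rightarrow> pool" where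
  "br (Few []) N = N"
| "br All N = All"
| "br (Few [m]) (Few ns) = Few (m # ns)"
| "br (Few (m # m' # ms)) (Few []) = Few (m # m' # ms)"
| "br (Br A B) (Few []) = Br A B"
| "br M N = Br M N"

fun some_hit :: "table \<Rightarrow> pair \<Rightarrow> trans list \<Rightarrow> bool" where
  "some_hit T p [] = False"
| "some_hit T p (m # ms) = (if hits T p m then True else some_hit T p ms)"

fun no_hits :: "table \<Rightarrow> pair \<Rightarrow> trans list \<Rightarrow> trans list" where
  "no_hits T p [] = []"
| "no_hits T p (m # ms) = (if hits T p m then no_hits T p ms else m # no_hits T p ms)"

fun can_hit :: "table \<Rightarrow> pair \<Rightarrow> pool \<Rightarrow> bool" where
  "can_hit T p All = True"
| "can_hit T p (Few ms) = some_hit T p ms"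
| "can_hit T p (Br M N) = (if can_hit T p M then True else can_hit T p N)"

fun without :: "table \<Rightarrow> pair \<Rightarrow> pool \<Rightarrow> pool" where
  "without T p All = All"
| "without T p (Few ms) = Few (no_hits T p ms)"
| "without T p (Br M N) = br (without T p M) (without T p N)"

fun withouts :: "table \<Rightarrow> pair list \<Rightarrow> pool \<Rightarrow> pool" where
  "withouts T [] M = M"
| "withouts T (p # ps) M = withouts T ps (without T p M)"

fun all_hit :: "table \<Rightarrow> pair list \<Rightarrow> pool \<Rightarrow> bool" where
  "all_hit T [] M = True"
| "all_hit T (p # ps) M = (if can_hit T p M then all_hit T ps M else False)"

fun witnessed :: "(pair list \<times> table) list \<Rightarrow> pool \<Rightarrow> bool" where
  "witnessed [] M = True"
| "witnessed ((ps, T) # pl) M = (if all_hit T ps M then witnessed pl M else False)"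

fun unhit :: "table \<Rightarrow> pair list \<Rightarrow> pool \<Rightarrow> pair list" where
  "unhit T [] M = []"
| "unhit T (p # ps) M = (if can_hit T p M then unhit T ps M else p # unhit T ps M)"

fun unhits :: "(pair list \<times> table) list \<Rightarrow> pool \<Rightarrow> (pair list \<times> table) list" where
  "unhits [] M = []"
| "unhits ((ps, T) # pl) M = (unhit T ps M, T) # unhits pl M"

fun hits_one :: "table \<Rightarrow> pair list \<Rightarrow> trans \<Rightarrow> bool" where
  "hits_one T [] m = False"
| "hits_one T (p # ps) m = (if hits T p m then True else hits_one T ps m)"

fun hitting :: "table \<Rightarrow> pair list \<Rightarrow> trans list \<Rightarrow> trans list" where
  "hitting T ps [] = []"
| "hitting T ps (m # ms) = (if hits_one T ps m then m # hitting T ps ms else hitting T ps ms)"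

fun missing_all :: "table \<Rightarrow> pair list \<Rightarrow> trans list \<Rightarrow> trans list" where
  "missing_all T ps [] = []"
| "missing_all T ps (m # ms) = (if hits_one T ps m then missing_all T ps ms else m # missing_all T ps ms)"

text \<open>Within one level only the maps hitting an undecided pair can be removed. The others are set aside for the
  duration of the level; placed pairs that have a witness among them need not be checked.\<close>
fun active :: "table \<Rightarrow> pair list \<Rightarrow> pool \<Rightarrow> pool" where
  "active T ps All = All"
| "active T ps (Few ms) = Few (hitting T ps ms)"
| "active T ps (Br M N) = br (active T ps M) (active T ps N)"

fun neutral :: "table \<Rightarrow> pair list \<Rightarrow> pool \<Rightarrow> pool" where
  "neutral T ps All = Few []"
| "neutral T ps (Few ms) = Few (missing_all T ps ms)"
| "neutral T ps (Br M N) = br (neutral T ps M) (neutral T ps N)"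

section \<open>Sets of states that avoid all close pairs\<close>

fun covers :: "row \<Rightarrow> pair \<Rightarrow> bool" where
  "covers K (x, y) = (if bit x K then bit y K else False)"

fun any_covers :: "row list \<Rightarrow> pair \<Rightarrow> bool" where
  "any_covers [] p = False"
| "any_covers (K # Ks) p = (if covers K p then True else any_covers Ks p)"

fun uncovered :: "row list \<Rightarrow> pair \<Rightarrow> row list" where
  "uncovered [] p = []"
| "uncovered (K # Ks) p = (if covers K p then uncovered Ks p else K # uncovered Ks p)"

fun count :: "nat \<Rightarrow> 'a list \<Rightarrow> nat" where
  "count t [] = t"
| "count t (x # xs) = count (Suc t) xs"

text \<open>For each size \<open>k\<close> the search keeps the \<open>k\<close>-sets not known to contain a pair of a decided level,
  and a cap on the least distance inside a \<open>k\<close>-set. At level \<open>t\<close> the pigeonhole bound for the cap is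
  \<open>t\<close> plus the number of remaining sets.\<close>
definition capped :: "nat \<Rightarrow> row list \<Rightarrow> nat \<times> row list" where
  "capped t Ks = (count t Ks, Ks)"

fun place :: "nat \<Rightarrow> pair \<Rightarrow> (nat \<times> row list) list \<Rightarrow> (nat \<times> row list) list" where
  "place t p [] = []"
| "place t p ((c, Ks) # un) =
    (if any_covers Ks p then capped t (uncovered Ks p) else (c, Ks)) # place t p un"

text \<open>With \<open>b\<close> one more than the permitted length, the result is \<open>0\<close> exactly when the caps still leave room
  for a counterexample.\<close>
fun missing :: "nat \<Rightarrow> (nat \<times> row list) list \<Rightarrow> nat" where
  "missing b [] = b"
| "missing b ((c, Ks) # un) = missing (b - c) un"

section \<open>Relabelling symmetries\<close>

fun same :: "state \<Rightarrow> state \<Rightarrow> bool" where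
  "same S0 S0 = True"
|   "same S1 S1 = True"
|   "same S2 S2 = True"
|   "same S3 S3 = True"
|   "same S4 S4 = True"
|   "same S5 S5 = True"
| "same x y = False"

fun before :: "state \<Rightarrow> state \<Rightarrow> bool" where
  "before S0 S1 = True"
|   "before S0 S2 = True"
|   "before S0 S3 = True"
|   "before S0 S4 = True"
|   "before S0 S5 = True"
|   "before S1 S2 = True"
|   "before S1 S3 = True"
|   "before S1 S4 = True"
|   "before S1 S5 = True"
|   "before S2 S3 = True"
|   "before S2 S4 = True"
|   "before S2 S5 = True"
|   "before S3 S4 = True"
|   "before S3 S5 = True"
|   "before S4 S5 = True"
| "before x y = False"

fun same_pair :: "pair \<Rightarrow> pair \<Rightarrow> bool" where
  "same_pair (x, y) (u, v) = (if same x u then same y v else False)"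

fun elem :: "pair \<Rightarrow> pair list \<Rightarrow> bool" where
  "elem p [] = False"
| "elem p (q # qs) = (if same_pair p q then True else elem p qs)"

fun diff :: "pair list \<Rightarrow> pair list \<Rightarrow> pair list" where
  "diff [] qs = []"
| "diff (p # ps) qs = (if elem p qs then diff ps qs else p # diff ps qs)"

fun swap :: "pair \<Rightarrow> state \<Rightarrow> state" where
  "swap (u, v) x = (if same x u then v else if same x v then u else x)"

fun sorted_pair :: "state \<Rightarrow> state \<Rightarrow> pair" where
  "sorted_pair x y = (if before x y then (x, y) else (y, x))"

fun swap_pair :: "pair \<Rightarrow> pair \<Rightarrow> pair" where
  "swap_pair s (x, y) = sorted_pair (swap s x) (swap s y)"

fun maps_into :: "pair \<Rightarrow> pair list \<Rightarrow> pair list \<Rightarrow> bool" where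
  "maps_into s qs [] = True"
| "maps_into s qs (p # ps) = (if elem (swap_pair s p) qs then maps_into s qs ps else False)"

text \<open>A symmetry is a transposition of labels, given by the pair of labels that it exchanges.\<close>
fun symmetries :: "pair list \<Rightarrow> pair list \<Rightarrow> pair list" where
  "symmetries qs [] = []"
| "symmetries qs (s # sy) = (if maps_into s qs qs then s # symmetries qs sy else symmetries qs sy)"

fun add_images :: "pair list \<Rightarrow> pair list \<Rightarrow> pair \<Rightarrow> pair list" where
  "add_images [] acc p = acc"
| "add_images (s # sy) acc p =
    (if elem (swap_pair s p) acc then add_images sy acc p else add_images sy (swap_pair s p # acc) p)"

fun add_all_images :: "pair list \<Rightarrow> pair list \<Rightarrow> pair list \<Rightarrow> pair list" where
  "add_all_images sy acc [] = acc"
| "add_all_images sy acc (p # ps) = add_all_images sy (add_images sy acc p) ps"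

text \<open>The images of \<open>p\<close> under products of at most two of the transpositions.\<close>
fun orbit :: "pair list \<Rightarrow> pair \<Rightarrow> pair list" where
  "orbit [] p = [p]"
| "orbit (s # sy) p = add_all_images (s # sy) (add_images (s # sy) [p] p) (add_images (s # sy) [p] p)"

fun join :: "'a list \<Rightarrow> 'a list \<Rightarrow> 'a list" where
  "join [] ys = ys"
| "join (x # xs) ys = x # join xs ys"

section \<open>The search by levels\<close>

text \<open>The fields are: the level to be determined next, the table of the level before it, the determined
  levels (latest first, each with the table of its predecessor), the undecided pairs, the pool, the caps with
  the remaining sets of size \<open>2, 3, \<dots>\<close>, and the symmetries.\<close>
datatype node = Node nat table "(pair list \<times> table) list" "pair list" pool "(nat \<times> row list) list" "pair list"

definition child :: "nat \<Rightarrow> table \<Rightarrow> (pair list \<times> table) list \<Rightarrow> pair list \<Rightarrow> pair list \<Rightarrow> pool \<Rightarrow> pair list \<Rightarrow> pool \<Rightarrow> (nat \<times> row list) list \<Rightarrow> node" where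
  "child t T pl und sy ns ins M un =
    Node (Suc t) (set_pairs ins no_table) ((ins, T) # pl) (diff und ins) (br ns M) un (symmetries ins sy)"

definition viable :: "table \<Rightarrow> (pair list \<times> table) list \<Rightarrow> pair list \<Rightarrow> pool \<Rightarrow> bool" where
  "viable T us ins M = (if all_hit T ins M then witnessed us M else False)"

text \<open>The last list holds the undecided pairs still to be treated; \<open>ins\<close> and \<open>outs\<close> record the pairs decided to be in
  the level or not, and \<open>skip\<close> the pairs excluded as members of an orbit. If the caps rule out that \<open>p\<close>
  is in the level, then \<open>p\<close> alone is excluded. Otherwise \<open>p\<close> is first put into the level, and afterwards its orbit is excluded.
  A level without pairs is impossible while pairs are undecided.\<close>
fun layer :: "nat \<Rightarrow> nat \<Rightarrow> table \<Rightarrow> (pair list \<times> table) list \<Rightarrow> (pair list \<times> table) list \<Rightarrow> pair list \<Rightarrow> pair list \<Rightarrow> pool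
    \<Rightarrow> (nat \<times> row list) list \<Rightarrow> pair list \<Rightarrow> pair list \<Rightarrow> pair list \<Rightarrow> pool \<Rightarrow> pair list \<Rightarrow> node list" where
  "layer b t T pl us und sy ns un outs skip ins M [] =
    (case ins of [] \<Rightarrow> [] | _ # _ \<Rightarrow> [child t T pl und sy ns ins M un])"
| "layer b t T pl us und sy ns un outs skip ins M (p # ps) =
    (if elem p skip then layer b t T pl us und sy ns un outs skip ins M ps
     else if can_hit T p M then
       (case missing b (place t p un) of
          Suc _ \<Rightarrow>
            (if viable T us ins (without T p M)
             then layer b t T pl us und sy ns un (p # outs) skip ins (without T p M) ps else [])
        | 0 \<Rightarrow>
            join (layer b t T pl us und sy ns (place t p un) outs skip (p # ins) M ps)
             (let os = orbit (symmetries outs (symmetries ins sy)) p in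
              if viable T us ins (withouts T os M)
              then layer b t T pl us und sy ns un (join os outs) (join os skip) ins (withouts T os M) ps else []))
     else layer b t T pl us und sy ns un (p # outs) skip ins M ps)"

fun fits :: "table \<Rightarrow> trans \<Rightarrow> state \<Rightarrow> state \<Rightarrow> state list \<Rightarrow> bool" where
  "fits T m x v [] = True"
| "fits T m x v (y # ys) = (if same v (img y m) then if entry T x y then fits T m x v ys else False else fits T m x v ys)"

text \<open>Lists the maps that merge only pairs of \<open>T\<close>, choosing the image of one state after the other; \<open>ys\<close> are the
  states whose image is chosen. The images of the last state are collected in one leaf.\<close>
fun extend :: "table \<Rightarrow> state list \<Rightarrow> state list \<Rightarrow> state list \<Rightarrow> trans \<Rightarrow> pool" where
  "extend T vs [] ys m = Few [m]"
| "extend T vs [x] ys m = Few (foldr (\<lambda>v ms. if fits T m x v ys then set_img x v m # ms else ms) vs [])"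
| "extend T vs (x # x' # xs) ys m =
    foldr (\<lambda>v. br (if fits T m x v ys then extend T vs (x' # xs) (x # ys) (set_img x v m) else Few [])) vs (Few [])"

definition base_map :: trans where "base_map = Trans S0 S0 S0 S0 S0 S0"

text \<open>The pool is created when level two is about to be determined, since level one consists of the pairs that
  some letter merges.\<close>
fun generate :: "state list \<Rightarrow> table \<Rightarrow> nat \<Rightarrow> pool \<Rightarrow> pool" where
  "generate vs T t (Few ms) = Few ms"
| "generate vs T t (Br M N) = Br M N"
| "generate vs T (Suc (Suc 0)) All = extend T vs vs [] base_map"
| "generate vs T t All = All"

section \<open>Choosing letters for a full layering\<close>

fun map_hitting :: "table \<Rightarrow> pair \<Rightarrow> trans list \<Rightarrow> trans list" where
  "map_hitting T p [] = []"
| "map_hitting T p (m # ms) = (if hits T p m then m # map_hitting T p ms else map_hitting T p ms)"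

fun candidates :: "table \<Rightarrow> pair \<Rightarrow> pool \<Rightarrow> trans list" where
  "candidates T p All = []"
| "candidates T p (Few ms) = map_hitting T p ms"
| "candidates T p (Br M N) = join (candidates T p M) (candidates T p N)"

fun flatten :: "(pair list \<times> table) list \<Rightarrow> (pair \<times> table) list \<Rightarrow> (pair \<times> table) list" where
  "flatten [] acc = acc"
| "flatten ((ps, T) # pl) acc = flatten pl (join (List.map (\<lambda>p. (p, T)) ps) acc)"

fun add_bit :: "bool \<Rightarrow> state \<Rightarrow> row \<Rightarrow> row" where
  "add_bit True x K = set_bit x True K"
| "add_bit False x K = K"

fun image :: "trans \<Rightarrow> row \<Rightarrow> row" where
  "image (Trans a b c d e f) (Row a' b' c' d' e' f') =
    add_bit a' a (add_bit b' b (add_bit c' c (add_bit d' d (add_bit e' e (add_bit f' f no_row)))))"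

fun singleton :: "row \<Rightarrow> bool" where
  "singleton (Row True False False False False False) = True"
|   "singleton (Row False True False False False False) = True"
|   "singleton (Row False False True False False False) = True"
|   "singleton (Row False False False True False False) = True"
|   "singleton (Row False False False False True False) = True"
|   "singleton (Row False False False False False True) = True"
| "singleton K = False"

fun apply_first :: "table \<Rightarrow> pair \<Rightarrow> row \<Rightarrow> trans list \<Rightarrow> row option" where
  "apply_first T p K [] = None"
| "apply_first T p K (m # ms) = (if hits T p m then Some (image m K) else apply_first T p K ms)"

fun greedy_step :: "(pair \<times> table) list \<Rightarrow> trans list \<Rightarrow> row \<Rightarrow> row option" where
  "greedy_step [] ms K = None"
| "greedy_step ((p, T) # al) ms K = (if covers K p then apply_first T p K ms else greedy_step al ms K)"

text \<open>Merges the first pair on the list \<open>al\<close> inside the current set by its chosen letter. The pairs of lowest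
  level come first.\<close>
fun greedy :: "nat \<Rightarrow> (pair \<times> table) list \<Rightarrow> trans list \<Rightarrow> row \<Rightarrow> bool" where
  "greedy 0 al ms K = singleton K"
| "greedy (Suc i) al ms K = (if singleton K then True else
    case greedy_step al ms K of None \<Rightarrow> False | Some K' \<Rightarrow> greedy i al ms K')"

fun same_bit :: "bool \<Rightarrow> bool \<Rightarrow> bool" where
  "same_bit True y = y"
| "same_bit False y = (if y then False else True)"

fun same_row :: "row \<Rightarrow> row \<Rightarrow> bool" where
  "same_row (Row a b c d e f) (Row a' b' c' d' e' f') = (if same_bit a a' then if same_bit b b' then
    if same_bit c c' then if same_bit d d' then if same_bit e e' then same_bit f f' else False
    else False else False else False else False)"

fun elem_row :: "row \<Rightarrow> row list \<Rightarrow> bool" where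
  "elem_row K [] = False"
| "elem_row K (J # Js) = (if same_row K J then True else elem_row K Js)"

fun any_singleton :: "row list \<Rightarrow> bool" where
  "any_singleton [] = False"
| "any_singleton (K # Ks) = (if singleton K then True else any_singleton Ks)"

fun successors :: "trans list \<Rightarrow> row \<Rightarrow> row list \<Rightarrow> row list \<Rightarrow> row list \<times> row list" where
  "successors [] K new old = (new, old)"
| "successors (m # ms) K new old = (if elem_row (image m K) old then successors ms K new old
    else successors ms K (image m K # new) (image m K # old))"

fun next_rows :: "trans list \<Rightarrow> row list \<Rightarrow> row list \<Rightarrow> row list \<Rightarrow> row list \<times> row list" where
  "next_rows ms [] new old = (new, old)"
| "next_rows ms (K # Ks) new old = (case successors ms K new old of (new', old') \<Rightarrow> next_rows ms Ks new' old')"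

text \<open>Where the greedy word is too long, all images of the set of states under the chosen letters are explored; \<open>old\<close> only avoids
  repetitions.\<close>
fun breadth :: "nat \<Rightarrow> trans list \<Rightarrow> row list \<Rightarrow> row list \<Rightarrow> bool" where
  "breadth 0 ms Ks old = any_singleton Ks"
| "breadth (Suc i) ms Ks old = (if any_singleton Ks then True else
    case next_rows ms Ks [] old of (new, old') \<Rightarrow> breadth i ms new old')"

text \<open>A pair that already has a witness among the chosen letters needs no new one.\<close>
fun assign :: "nat \<Rightarrow> row \<Rightarrow> (pair \<times> table) list \<Rightarrow> pool \<Rightarrow> (pair \<times> table) list \<Rightarrow> trans list \<Rightarrow> bool" where
  "assign l K al M [] ms = (if greedy l al ms K then True else breadth l ms [K] [K])"
| "assign l K al M ((p, T) # r) ms = (if some_hit T p ms then assign l K al M r ms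
    else list_all (\<lambda>m. assign l K al M r (m # ms)) (candidates T p M))"

definition layers :: "nat \<Rightarrow> nat \<Rightarrow> table \<Rightarrow> (pair list \<times> table) list \<Rightarrow> pair list \<Rightarrow> pair list \<Rightarrow> (nat \<times> row list) list \<Rightarrow> pool \<Rightarrow> node list" where
  "layers b t T pl und sy un M = (if witnessed pl M then
    layer b t T pl (unhits pl (neutral T und M)) und sy (neutral T und M) un [] [] [] (active T und M) und else [])"

fun children :: "nat \<Rightarrow> state list \<Rightarrow> node \<Rightarrow> node list" where
  "children l vs (Node t T pl und M un sy) = layers (Suc l) t T pl und sy un (generate vs T t M)"

fun full_row :: "state list \<Rightarrow> row" where
  "full_row [] = no_row"
| "full_row (x # xs) = set_bit x True (full_row xs)"

text \<open>An unrestricted pool cannot be enumerated, so a full layering with such a pool must not count as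
  refuted.\<close>
fun known :: "pool \<Rightarrow> bool" where
  "known All = False"
| "known (Few ms) = True"
| "known (Br M N) = (if known M then known N else False)"

text \<open>The number bounds the depth. There are at most as many levels as pairs, so \<open>20\<close> is enough for six
  states.\<close>
fun search :: "nat \<Rightarrow> state list \<Rightarrow> nat \<Rightarrow> node \<Rightarrow> bool" where
  "search l vs 0 nd = False"
| "search l vs (Suc i) (Node t T pl [] M un sy) =
    (if known M then assign l (full_row vs) (flatten pl []) M (flatten pl []) [] else False)"
| "search l vs (Suc i) (Node t T pl (p # ps) M un sy) =
    list_all (search l vs i) (children l vs (Node t T pl (p # ps) M un sy))"

fun pairs :: "state list \<Rightarrow> pair list" where
  "pairs [] = []"
| "pairs (x # xs) = List.map (Pair x) xs @ pairs xs"

fun subsets :: "nat \<Rightarrow> state list \<Rightarrow> row list" where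
  "subsets 0 xs = [no_row]"
| "subsets (Suc k) [] = []"
| "subsets (Suc k) (x # xs) = List.map (set_bit x True) (subsets k xs) @ subsets (Suc k) xs"

definition root :: "nat list \<Rightarrow> state list \<Rightarrow> node" where
  "root ks vs = Node (Suc 0) diagonal [] (pairs vs) All (List.map (\<lambda>k. capped 0 (subsets k vs)) ks) (pairs vs)"

section \<open>Equations for evaluation\<close>

text \<open>Rewriting a conditional visits the data in both branches before the condition is
  decided. The following equations instead hand the condition to an auxiliary function that matches on its value,
  and they match pairs against constants in place of projecting from them. Each auxiliary function is the conditional it
  replaces.\<close>
lemma hits_code [code]:
  "hits T (S0, S1) (Trans a b c d e f) = bit b (line a T)"
  "hits T (S0, S2) (Trans a b c d e f) = bit c (line a T)"
  "hits T (S0, S3) (Trans a b c d e f) = bit d (line a T)"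
  "hits T (S0, S4) (Trans a b c d e f) = bit e (line a T)"
  "hits T (S0, S5) (Trans a b c d e f) = bit f (line a T)"
  "hits T (S1, S2) (Trans a b c d e f) = bit c (line b T)"
  "hits T (S1, S3) (Trans a b c d e f) = bit d (line b T)"
  "hits T (S1, S4) (Trans a b c d e f) = bit e (line b T)"
  "hits T (S1, S5) (Trans a b c d e f) = bit f (line b T)"
  "hits T (S2, S3) (Trans a b c d e f) = bit d (line c T)"
  "hits T (S2, S4) (Trans a b c d e f) = bit e (line c T)"
  "hits T (S2, S5) (Trans a b c d e f) = bit f (line c T)"
  "hits T (S3, S4) (Trans a b c d e f) = bit e (line d T)"
  "hits T (S3, S5) (Trans a b c d e f) = bit f (line d T)"
  "hits T (S4, S5) (Trans a b c d e f) = bit f (line e T)"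
  by (simp_all add: hits_def entry_def)

definition unless_map :: "bool \<Rightarrow> trans \<Rightarrow> trans list \<Rightarrow> trans list" where "unless_map c m ms = (if c then ms else m # ms)"

lemma [code]: "unless_map True m ms = ms" "unless_map False m ms = m # ms"
  by (simp_all add: unless_map_def)

definition unless_row :: "bool \<Rightarrow> row \<Rightarrow> row list \<Rightarrow> row list" where "unless_row c m ms = (if c then ms else m # ms)"

lemma [code]: "unless_row True m ms = ms" "unless_row False m ms = m # ms"
  by (simp_all add: unless_row_def)

definition unless_pair :: "bool \<Rightarrow> pair \<Rightarrow> pair list \<Rightarrow> pair list" where "unless_pair c m ms = (if c then ms else m # ms)"

lemma [code]: "unless_pair True m ms = ms" "unless_pair False m ms = m # ms"
  by (simp_all add: unless_pair_def)

definition when_map :: "bool \<Rightarrow> trans \<Rightarrow> trans list \<Rightarrow> trans list" where "when_map c m ms = (if c then m # ms else ms)"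

lemma [code]: "when_map True m ms = m # ms" "when_map False m ms = ms"
  by (simp_all add: when_map_def)

text \<open>The arguments of a test that stay the same for all maps are bundled, because every argument of a rewritten term costs
  time.\<close>
datatype probe = Probe table pair

fun probe_hits :: "probe \<Rightarrow> trans \<Rightarrow> bool" where "probe_hits (Probe T p) m = hits T p m"

fun probe_some :: "probe \<Rightarrow> trans list \<Rightarrow> bool" where "probe_some (Probe T p) ms = some_hit T p ms"

fun probe_none :: "probe \<Rightarrow> trans list \<Rightarrow> trans list" where "probe_none (Probe T p) ms = no_hits T p ms"

fun probe_can :: "probe \<Rightarrow> pool \<Rightarrow> bool" where "probe_can (Probe T p) M = can_hit T p M"

fun probe_without :: "probe \<Rightarrow> pool \<Rightarrow> pool" where "probe_without (Probe T p) M = without T p M"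

definition or_probe_some where "or_probe_some c q ms = (if c then True else probe_some q ms)"

definition or_probe_can where "or_probe_can c q M = (if c then True else probe_can q M)"

lemma [code]:
  "probe_hits (Probe T (S0, S1)) (Trans a b c d e f) = bit b (line a T)"
  "probe_hits (Probe T (S0, S2)) (Trans a b c d e f) = bit c (line a T)"
  "probe_hits (Probe T (S0, S3)) (Trans a b c d e f) = bit d (line a T)"
  "probe_hits (Probe T (S0, S4)) (Trans a b c d e f) = bit e (line a T)"
  "probe_hits (Probe T (S0, S5)) (Trans a b c d e f) = bit f (line a T)"
  "probe_hits (Probe T (S1, S2)) (Trans a b c d e f) = bit c (line b T)"
  "probe_hits (Probe T (S1, S3)) (Trans a b c d e f) = bit d (line b T)"
  "probe_hits (Probe T (S1, S4)) (Trans a b c d e f) = bit e (line b T)"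
  "probe_hits (Probe T (S1, S5)) (Trans a b c d e f) = bit f (line b T)"
  "probe_hits (Probe T (S2, S3)) (Trans a b c d e f) = bit d (line c T)"
  "probe_hits (Probe T (S2, S4)) (Trans a b c d e f) = bit e (line c T)"
  "probe_hits (Probe T (S2, S5)) (Trans a b c d e f) = bit f (line c T)"
  "probe_hits (Probe T (S3, S4)) (Trans a b c d e f) = bit e (line d T)"
  "probe_hits (Probe T (S3, S5)) (Trans a b c d e f) = bit f (line d T)"
  "probe_hits (Probe T (S4, S5)) (Trans a b c d e f) = bit f (line e T)"
  by (simp_all add: hits_code)

lemma [code]: "or_probe_some True q ms = True" "or_probe_some False q ms = probe_some q ms"
  by (simp_all add: or_probe_some_def)

lemma [code]: "probe_some q [] = False" "probe_some q (m # ms) = or_probe_some (probe_hits q m) q ms"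
  by (cases q; simp add: or_probe_some_def)+

lemma [code]: "probe_none q [] = []" "probe_none q (m # ms) = unless_map (probe_hits q m) m (probe_none q ms)"
  by (cases q; simp add: unless_map_def)+

lemma [code]: "or_probe_can True q M = True" "or_probe_can False q M = probe_can q M"
  by (simp_all add: or_probe_can_def)

lemma [code]: "probe_can q All = True" "probe_can q (Few ms) = probe_some q ms"
  "probe_can q (Br M N) = or_probe_can (probe_can q M) q N"
  by (cases q; simp add: or_probe_can_def)+

lemma [code]: "probe_without q All = All" "probe_without q (Few ms) = Few (probe_none q ms)"
  "probe_without q (Br M N) = br (probe_without q M) (probe_without q N)"
  by (cases q; simp)+

lemma [code]: "some_hit T p ms = probe_some (Probe T p) ms" "can_hit T p M = probe_can (Probe T p) M"
  "without T p M = probe_without (Probe T p) M"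
  by simp_all

definition and_all_hit where "and_all_hit c T ps M = (if c then all_hit T ps M else False)"

lemma [code]: "and_all_hit True T ps M = all_hit T ps M" "and_all_hit False T ps M = False"
  by (simp_all add: and_all_hit_def)

lemma [code]: "all_hit T [] M = True" "all_hit T (p # ps) M = and_all_hit (can_hit T p M) T ps M"
  by (simp_all add: and_all_hit_def)

definition and_witnessed where "and_witnessed c pl M = (if c then witnessed pl M else False)"

lemma [code]: "and_witnessed True pl M = witnessed pl M" "and_witnessed False pl M = False"
  by (simp_all add: and_witnessed_def)

lemma [code]: "witnessed [] M = True" "witnessed ((ps, T) # pl) M = and_witnessed (all_hit T ps M) pl M"
  by (simp_all add: and_witnessed_def)

lemma [code]: "unhit T [] M = []" "unhit T (p # ps) M = unless_pair (can_hit T p M) p (unhit T ps M)"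
  by (simp_all add: unless_pair_def)

definition or_hits_one where "or_hits_one c T ps m = (if c then True else hits_one T ps m)"

lemma [code]: "or_hits_one True T ps m = True" "or_hits_one False T ps m = hits_one T ps m"
  by (simp_all add: or_hits_one_def)

lemma [code]: "hits_one T [] m = False" "hits_one T (p # ps) m = or_hits_one (hits T p m) T ps m"
  by (simp_all add: or_hits_one_def)

lemma [code]: "hitting T ps [] = []" "hitting T ps (m # ms) = when_map (hits_one T ps m) m (hitting T ps ms)"
  by (simp_all add: when_map_def)

lemma [code]: "missing_all T ps [] = []" "missing_all T ps (m # ms) = unless_map (hits_one T ps m) m (missing_all T ps ms)"
  by (simp_all add: unless_map_def)

lemma [code]: "map_hitting T p [] = []" "map_hitting T p (m # ms) = when_map (hits T p m) m (map_hitting T p ms)"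
  by (simp_all add: when_map_def)

definition or_any_covers where "or_any_covers c Ks p = (if c then True else any_covers Ks p)"

lemma [code]: "or_any_covers True Ks p = True" "or_any_covers False Ks p = any_covers Ks p"
  by (simp_all add: or_any_covers_def)

lemma [code]: "any_covers [] p = False" "any_covers (K # Ks) p = or_any_covers (covers K p) Ks p"
  by (simp_all add: or_any_covers_def)

lemma [code]: "uncovered [] p = []" "uncovered (K # Ks) p = unless_row (covers K p) K (uncovered Ks p)"
  by (simp_all add: unless_row_def)

definition place_if where "place_if c t p d Ks = (if c then capped t (uncovered Ks p) else (d, Ks))"

lemma [code]: "place_if True t p d Ks = capped t (uncovered Ks p)" "place_if False t p d Ks = (d, Ks)"
  by (simp_all add: place_if_def)

lemma [code]: "place t p [] = []" "place t p ((c, Ks) # un) = place_if (any_covers Ks p) t p c Ks # place t p un"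
  by (simp_all add: place_if_def)

definition or_elem where "or_elem c p qs = (if c then True else elem p qs)"

lemma [code]: "or_elem True p qs = True" "or_elem False p qs = elem p qs"
  by (simp_all add: or_elem_def)

lemma [code]: "elem p [] = False" "elem p (q # qs) = or_elem (same_pair p q) p qs"
  by (simp_all add: or_elem_def)

lemma [code]: "diff [] qs = []" "diff (p # ps) qs = unless_pair (elem p qs) p (diff ps qs)"
  by (simp_all add: unless_pair_def)

lemma [code]: "viable T us ins M = and_witnessed (all_hit T ins M) us M"
  by (simp add: viable_def and_witnessed_def)

definition layer_viable where "layer_viable c b t T pl us und sy ns un outs skip ins M ps = (if c then layer b t T pl us und sy ns un outs skip ins M ps else [])"

lemma [code]: "layer_viable True b t T pl us und sy ns un outs skip ins M ps = layer b t T pl us und sy ns un outs skip ins M ps" "layer_viable False b t T pl us und sy ns un outs skip ins M ps = []"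
  by (simp_all add: layer_viable_def)

definition layer_out where "layer_out os b t T pl us und sy ns un outs skip ins M ps =
  layer_viable (viable T us ins M) b t T pl us und sy ns un (join os outs) skip ins M ps"

definition layer_orbit where "layer_orbit os b t T pl us und sy ns un outs skip ins M ps =
  layer_out os b t T pl us und sy ns un outs (join os skip) ins (withouts T os M) ps"

definition layer_in where "layer_in r un' b t T pl us und sy ns un outs skip ins M p ps = (case r of
    Suc _ \<Rightarrow> layer_out [p] b t T pl us und sy ns un outs skip ins (without T p M) ps
  | 0 \<Rightarrow> join (layer b t T pl us und sy ns un' outs skip (p # ins) M ps)
      (layer_orbit (orbit (symmetries outs (symmetries ins sy)) p) b t T pl us und sy ns un outs skip ins M ps))"

lemma [code]:
  "layer_in (Suc k) un' b t T pl us und sy ns un outs skip ins M p ps =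
    layer_out [p] b t T pl us und sy ns un outs skip ins (without T p M) ps"
  "layer_in 0 un' b t T pl us und sy ns un outs skip ins M p ps =
    join (layer b t T pl us und sy ns un' outs skip (p # ins) M ps)
      (layer_orbit (orbit (symmetries outs (symmetries ins sy)) p) b t T pl us und sy ns un outs skip ins M ps)"
  by (simp_all add: layer_in_def)

definition layer_place where "layer_place un' b t T pl us und sy ns un outs skip ins M p ps =
  layer_in (missing b un') un' b t T pl us und sy ns un outs skip ins M p ps"

definition layer_hit where "layer_hit c b t T pl us und sy ns un outs skip ins M p ps = (if c then layer_place (place t p un) b t T pl us und sy ns un outs skip ins M p ps else layer b t T pl us und sy ns un (p # outs) skip ins M ps)"

lemma [code]: "layer_hit True b t T pl us und sy ns un outs skip ins M p ps = layer_place (place t p un) b t T pl us und sy ns un outs skip ins M p ps" "layer_hit False b t T pl us und sy ns un outs skip ins M p ps = layer b t T pl us und sy ns un (p # outs) skip ins M ps"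
  by (simp_all add: layer_hit_def)

definition layer_skip where "layer_skip c b t T pl us und sy ns un outs skip ins M p ps = (if c then layer b t T pl us und sy ns un outs skip ins M ps else layer_hit (can_hit T p M) b t T pl us und sy ns un outs skip ins M p ps)"

lemma [code]: "layer_skip True b t T pl us und sy ns un outs skip ins M p ps = layer b t T pl us und sy ns un outs skip ins M ps" "layer_skip False b t T pl us und sy ns un outs skip ins M p ps = layer_hit (can_hit T p M) b t T pl us und sy ns un outs skip ins M p ps"
  by (simp_all add: layer_skip_def)

lemma [code]:
  "layer b t T pl us und sy ns un outs skip [] M [] = []"
  "layer b t T pl us und sy ns un outs skip (q # ins) M [] = [child t T pl und sy ns (q # ins) M un]"
  "layer b t T pl us und sy ns un outs skip ins M (p # ps) =
    layer_skip (elem p skip) b t T pl us und sy ns un outs skip ins M p ps"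
  by (simp_all add: layer_skip_def layer_hit_def layer_place_def layer_in_def layer_orbit_def layer_out_def
      layer_viable_def Let_def split: nat.split)

definition extend_last where "extend_last T x ys m ws = foldr (\<lambda>v ms. if fits T m x v ys then set_img x v m # ms else ms) ws []"

lemma [code]: "extend_last T x ys m [] = []"
  "extend_last T x ys m (v # ws) = when_map (fits T m x v ys) (set_img x v m) (extend_last T x ys m ws)"
  by (simp_all add: extend_last_def when_map_def)

definition extend_each where "extend_each T vs x' x xs ys m ws =
  foldr (\<lambda>v. br (if fits T m x v ys then extend T vs (x' # xs) (x # ys) (set_img x v m) else Few [])) ws (Few [])"

definition extend_if where "extend_if c T vs x' x xs ys m v = (if c then extend T vs (x' # xs) (x # ys) (set_img x v m) else Few [])"

lemma [code]: "extend_if True T vs x' x xs ys m v = extend T vs (x' # xs) (x # ys) (set_img x v m)" "extend_if False T vs x' x xs ys m v = Few []"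
  by (simp_all add: extend_if_def)

lemma [code]: "extend_each T vs x' x xs ys m [] = Few []"
  "extend_each T vs x' x xs ys m (v # ws) = br (extend_if (fits T m x v ys) T vs x' x xs ys m v) (extend_each T vs x' x xs ys m ws)"
  by (simp_all add: extend_each_def extend_if_def)

lemma [code]: "extend T vs [] ys m = Few [m]" "extend T vs [x] ys m = Few (extend_last T x ys m vs)"
  "extend T vs (x # x' # xs) ys m = extend_each T vs x' x xs ys m vs"
  by (simp_all add: extend_each_def extend_last_def)

definition split_maps where "split_maps T ps ms = (hitting T ps ms, missing_all T ps ms)"

fun put_map :: "bool \<Rightarrow> trans \<Rightarrow> trans list \<times> trans list \<Rightarrow> trans list \<times> trans list" where
  "put_map True m (as, ns) = (m # as, ns)"
| "put_map False m (as, ns) = (as, m # ns)"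

lemma [code]: "split_maps T ps [] = ([], [])"
  "split_maps T ps (m # ms) = put_map (hits_one T ps m) m (split_maps T ps ms)"
  by (cases "hits_one T ps m"; simp add: split_maps_def)+

fun few_both where "few_both (as, ns) = (Few as, Few ns)"

fun br_both where "br_both (A, N) (A', N') = (br A A', br N N')"

definition split_pool where "split_pool T ps M = (active T ps M, neutral T ps M)"

lemma [code]: "split_pool T ps All = (All, Few [])" "split_pool T ps (Few ms) = few_both (split_maps T ps ms)"
  "split_pool T ps (Br M N) = br_both (split_pool T ps M) (split_pool T ps N)"
  by (simp_all add: split_pool_def split_maps_def)

definition layers_unhit where "layers_unhit us b t T pl und sy un ns M =
  layer b t T pl us und sy ns un [] [] [] M und"

fun layers_split where "layers_split b t T pl und sy un (M, ns) =
  layers_unhit (unhits pl ns) b t T pl und sy un ns M"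

definition layers_if where "layers_if c b t T pl und sy un M = (if c then layers_split b t T pl und sy un (split_pool T und M) else [])"

lemma [code]: "layers_if True b t T pl und sy un M = layers_split b t T pl und sy un (split_pool T und M)" "layers_if False b t T pl und sy un M = []"
  by (simp_all add: layers_if_def)

lemma [code]: "layers b t T pl und sy un M = layers_if (witnessed pl M) b t T pl und sy un M"
  by (simp add: layers_if_def layers_unhit_def split_pool_def layers_def)

definition search_all where "search_all l vs i nds = list_all (search l vs i) nds"

definition and_search_all where "and_search_all c l vs i nds = (if c then search_all l vs i nds else False)"

lemma [code]: "and_search_all True l vs i nds = search_all l vs i nds" "and_search_all False l vs i nds = False"
  by (simp_all add: and_search_all_def)

lemma [code]: "search_all l vs i [] = True"
  "search_all l vs i (nd # nds) = and_search_all (search l vs i nd) l vs i nds"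
  by (simp_all add: search_all_def and_search_all_def)

definition assign_all where "assign_all al l K M = assign l K al M al []"

definition if_known where "if_known c l K M pl = (if c then assign_all (flatten pl []) l K M else False)"

lemma [code]: "if_known True l K M pl = assign_all (flatten pl []) l K M" "if_known False l K M pl = False"
  by (simp_all add: if_known_def)

lemma [code]: "search l vs 0 nd = False"
  "search l vs (Suc i) (Node t T pl [] M un sy) = if_known (known M) l (full_row vs) M pl"
  "search l vs (Suc i) (Node t T pl (p # ps) M un sy) =
    search_all l vs i (layers (Suc l) t T pl (p # ps) sy un (generate vs T t M))"
  by (simp_all add: search_all_def assign_all_def if_known_def)

section \<open>Reset words and pair distances\<close>

definition act :: "trans list \<Rightarrow> state \<Rightarrow> state" where
  "act w x = foldl (\<lambda>y m. img y m) x w"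

lemma act_Nil [simp]: "act [] x = x" by (simp add: act_def)

lemma act_Cons [simp]: "act (m # w) x = act w (img x m)" by (simp add: act_def)

lemma act_append [simp]: "act (v @ w) x = act w (act v x)" by (simp add: act_def)

definition collapsible :: "trans set \<Rightarrow> nat \<Rightarrow> state set \<Rightarrow> bool" where
  "collapsible F l X \<longleftrightarrow> (\<exists>w s. set w \<subseteq> F \<and> length w \<le> l \<and> act w ` X = {s})"

lemma collapsible_singleton: "X = {s} \<Longrightarrow> collapsible F l X"
  unfolding collapsible_def by (rule exI[of _ "[]"]) auto

lemma collapsible_word:
  assumes "set v \<subseteq> F" "collapsible F l (act v ` X)"
  shows "collapsible F (length v + l) X"
proof -
  obtain w s where "set w \<subseteq> F" "length w \<le> l" "act w ` (act v ` X) = {s}"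
    using assms unfolding collapsible_def by blast
  then show ?thesis using assms(1) unfolding collapsible_def
    by (intro exI[of _ "v @ w"] exI[of _ s]) (auto simp: image_image)
qed

lemma collapsible_letter: "m \<in> F \<Longrightarrow> collapsible F l ((\<lambda>x. img x m) ` X) \<Longrightarrow> collapsible F (Suc l) X"
  using collapsible_word[of "[m]" F l X] by simp

lemma collapsible_mono: "collapsible F l X \<Longrightarrow> l \<le> l' \<Longrightarrow> collapsible F l' X"
  unfolding collapsible_def by (meson order_trans)

text \<open>The properties of pair distances and letters of a counterexample with states \<open>set vs\<close> and length bound
  \<open>lim\<close>. Outside of \<open>set vs\<close> the letters have the value \<open>S0\<close>, so that they are determined by their
  restriction to \<open>set vs\<close>.\<close>
definition cex :: "state list \<Rightarrow> nat \<Rightarrow> (state \<Rightarrow> state \<Rightarrow> nat) \<Rightarrow> trans set \<Rightarrow> bool" where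
  "cex vs lim d F \<longleftrightarrow>
    (\<forall>x y. d x y = d y x) \<and> (\<forall>x\<in>set vs. \<forall>y\<in>set vs. d x y = 0 \<longleftrightarrow> x = y) \<and>
    (\<forall>m\<in>F. \<forall>x\<in>set vs. img x m \<in> set vs) \<and> (\<forall>m\<in>F. \<forall>x. x \<notin> set vs \<longrightarrow> img x m = S0) \<and>
    (\<forall>m\<in>F. \<forall>x\<in>set vs. \<forall>y\<in>set vs. d x y \<le> Suc (d (img x m) (img y m))) \<and>
    (\<forall>x\<in>set vs. \<forall>y\<in>set vs. x \<noteq> y \<longrightarrow> (\<exists>m\<in>F. d x y = Suc (d (img x m) (img y m)))) \<and>
    \<not> collapsible F lim (set vs)"

lemma cexD:
  assumes "cex vs lim d F"
  shows cex_sym: "d x y = d y x"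
    and cex_zero: "x \<in> set vs \<Longrightarrow> y \<in> set vs \<Longrightarrow> d x y = 0 \<longleftrightarrow> x = y"
    and cex_closed: "m \<in> F \<Longrightarrow> x \<in> set vs \<Longrightarrow> img x m \<in> set vs"
    and cex_padded: "m \<in> F \<Longrightarrow> x \<notin> set vs \<Longrightarrow> img x m = S0"
    and cex_step: "m \<in> F \<Longrightarrow> x \<in> set vs \<Longrightarrow> y \<in> set vs \<Longrightarrow> d x y \<le> Suc (d (img x m) (img y m))"
    and cex_witness: "x \<in> set vs \<Longrightarrow> y \<in> set vs \<Longrightarrow> x \<noteq> y \<Longrightarrow> \<exists>m\<in>F. d x y = Suc (d (img x m) (img y m))"
    and cex_not_collapsible: "\<not> collapsible F lim (set vs)"
proof -
  show "d x y = d y x" using conjunct1[OF assms[unfolded cex_def]] by simp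
  note rest = conjunct2[OF assms[unfolded cex_def]]
  show "x \<in> set vs \<Longrightarrow> y \<in> set vs \<Longrightarrow> d x y = 0 \<longleftrightarrow> x = y"
    and "m \<in> F \<Longrightarrow> x \<in> set vs \<Longrightarrow> img x m \<in> set vs"
    and "m \<in> F \<Longrightarrow> x \<notin> set vs \<Longrightarrow> img x m = S0"
    and "m \<in> F \<Longrightarrow> x \<in> set vs \<Longrightarrow> y \<in> set vs \<Longrightarrow> d x y \<le> Suc (d (img x m) (img y m))"
    and "x \<in> set vs \<Longrightarrow> y \<in> set vs \<Longrightarrow> x \<noteq> y \<Longrightarrow> \<exists>m\<in>F. d x y = Suc (d (img x m) (img y m))"
    and "\<not> collapsible F lim (set vs)"
    using rest by simp_all
qed

text \<open>Follow witnesses: each of them brings the two states nearer by one.\<close>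
lemma merging_word:
  assumes C: "cex vs lim d F"
  shows "x \<in> set vs \<Longrightarrow> y \<in> set vs \<Longrightarrow> \<exists>w. set w \<subseteq> F \<and> length w = d x y \<and> act w x = act w y"
proof (induction "d x y" arbitrary: x y)
  case 0
  then have "x = y" using cex_zero[OF C] by metis
  then show ?case using 0 by (intro exI[of _ "[]"]) auto
next
  case (Suc k)
  then have "x \<noteq> y" using cex_zero[OF C] by (metis nat.distinct(1))
  then obtain m where m: "m \<in> F" "d x y = Suc (d (img x m) (img y m))"
    using cex_witness[OF C] Suc.prems by blast
  have k: "k = d (img x m) (img y m)" using Suc.hyps(2) m(2) by simp
  obtain w where "set w \<subseteq> F" "length w = d (img x m) (img y m)" "act w (img x m) = act w (img y m)"
    using Suc.hyps(1)[OF k] cex_closed[OF C m(1)] Suc.prems by blast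
  then show ?case using m by (intro exI[of _ "m # w"]) auto
qed

lemma act_closed: "cex vs lim d F \<Longrightarrow> set w \<subseteq> F \<Longrightarrow> x \<in> set vs \<Longrightarrow> act w x \<in> set vs"
  by (induction w arbitrary: x) (auto simp: cex_closed)

definition near :: "(state \<Rightarrow> state \<Rightarrow> nat) \<Rightarrow> state set \<Rightarrow> nat \<Rightarrow> bool" where
  "near d S c \<longleftrightarrow> (\<exists>x\<in>S. \<exists>y\<in>S. x \<noteq> y \<and> d x y \<le> c)"

lemma near_mono: "near d S c \<Longrightarrow> c \<le> c' \<Longrightarrow> near d S c'"
  unfolding near_def by (meson order_trans)

text \<open>A word merging a closest pair of \<open>S\<close> costs at most the cap for the size of \<open>S\<close>, and its image has smaller
  size. Caps of sizes that are jumped over only make the bound larger. The index is shifted: \<open>c k\<close> belongs to sets of size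
  \<open>k + 2\<close>.\<close>
lemma greedy_collapse:
  assumes C: "cex vs lim d F"
    and caps: "\<And>k S. k < n - Suc 0 \<Longrightarrow> S \<subseteq> set vs \<Longrightarrow> card S = Suc (Suc k) \<Longrightarrow> near d S (c k)"
  shows "S \<subseteq> set vs \<Longrightarrow> S \<noteq> {} \<Longrightarrow> card S \<le> n \<Longrightarrow> collapsible F (\<Sum>k<card S - Suc 0. c k) S"
proof (induction "card S" arbitrary: S rule: less_induct)
  case less
  have fin: "finite S" using finite_subset[OF less.prems(1)] by simp
  have pos: "card S > 0" using fin less.prems(2) by (simp add: card_gt_0_iff)
  show ?case
  proof (cases "card S = Suc 0")
    case True
    then obtain s where "S = {s}" by (auto simp: card_Suc_eq)
    then show ?thesis by (rule collapsible_singleton)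
  next
    case False
    define k where "k = card S - 2"
    have k: "card S = Suc (Suc k)" "k < n - Suc 0" using False pos less.prems(3) by (auto simp: k_def)
    obtain x y where xy: "x \<in> S" "y \<in> S" "x \<noteq> y" "d x y \<le> c k"
      using caps[OF k(2) less.prems(1) k(1)] unfolding near_def by blast
    obtain w where w: "set w \<subseteq> F" "length w = d x y" "act w x = act w y"
      using merging_word[OF C] xy less.prems(1) by blast
    let ?S = "act w ` S"
    have "act w x \<in> act w ` (S - {x})" using xy by (auto simp: w(3))
    moreover have "S = insert x (S - {x})" using xy by blast
    ultimately have "?S = act w ` (S - {x})" by (metis image_insert insert_absorb)
    then have lt: "card ?S \<le> Suc k" using card_image_le[of "S - {x}" "act w"] fin xy(1) k(1) by simp
    have sub: "?S \<subseteq> set vs" using less.prems(1) act_closed[OF C w(1)] by blast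
    have "collapsible F (\<Sum>j<card ?S - Suc 0. c j) ?S"
      using less.hyps[of ?S] lt k(1) sub less.prems by simp
    then have "collapsible F (\<Sum>j<k. c j) ?S"
      by (rule collapsible_mono) (use lt in \<open>auto intro!: sum_mono2\<close>)
    then have "collapsible F (length w + (\<Sum>j<k. c j)) S" by (rule collapsible_word[OF w(1)])
    then show ?thesis by (rule collapsible_mono) (use w(2) xy(4) k in simp)
  qed
qed

text \<open>Let the least distance in \<open>S\<close> be \<open>i + 1\<close>, where \<open>i \<ge> 1\<close>. A witness for a closest pair lowers that pair to \<open>i\<close> and
  all other pairs to no less than \<open>i\<close>, in particular it merges none; so the image is a set of the same size with least
  distance \<open>i\<close>. Descending in this way, every value above \<open>t\<close> up to the least distance in \<open>S\<close> occurs
  for some member of \<open>A\<close>, and different values occur for different members.\<close>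
lemma pigeonhole_cap:
  assumes C: "cex vs lim d F" and A: "finite A"
    and all: "\<And>S. S \<subseteq> set vs \<Longrightarrow> card S = k \<Longrightarrow> \<not> near d S t \<Longrightarrow> S \<in> A"
    and S: "S \<subseteq> set vs" "card S = k" and k: "k \<ge> 2"
  shows "near d S (t + card A)"
proof (rule ccontr)
  assume far: "\<not> near d S (t + card A)"
  \<comment> \<open>The least distance in \<open>S\<close> is \<open>i + 1\<close>.\<close>
  define P where "P i S \<longleftrightarrow> S \<subseteq> set vs \<and> card S = k \<and> \<not> near d S i \<and> near d S (Suc i)" for i S
  have descend: "\<exists>S'. P i S'" if "P (Suc i) S" for i S
  proof -
    have S: "S \<subseteq> set vs" "card S = k" "\<not> near d S (Suc i)" using that unfolding P_def by auto
    then have big: "d x y \<ge> Suc (Suc i)" if "x \<in> S" "y \<in> S" "x \<noteq> y" for x y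
      using that unfolding near_def by force
    obtain x y where xy: "x \<in> S" "y \<in> S" "x \<noteq> y" "d x y \<le> Suc (Suc i)"
      using \<open>P (Suc i) S\<close> unfolding P_def near_def by blast
    obtain m where m: "m \<in> F" "d x y = Suc (d (img x m) (img y m))"
      using cex_witness[OF C] xy S(1) by blast
    have img_big: "d (img u m) (img v m) \<ge> Suc i" if "u \<in> S" "v \<in> S" "u \<noteq> v" for u v
      using cex_step[OF C m(1), of u v] big[OF that] that S(1) by fastforce
    have inj: "inj_on (\<lambda>u. img u m) S"
    proof (rule inj_onI, rule ccontr)
      fix u v assume uv: "u \<in> S" "v \<in> S" "img u m = img v m" "u \<noteq> v"
      then have "d (img u m) (img v m) = 0" using cex_zero[OF C] cex_closed[OF C m(1)] S(1) by auto
      then show False using img_big[OF uv(1,2,4)] by simp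
    qed
    have "P i ((\<lambda>u. img u m) ` S)" unfolding P_def
    proof (intro conjI)
      show "(\<lambda>u. img u m) ` S \<subseteq> set vs" using S(1) cex_closed[OF C m(1)] by blast
      show "card ((\<lambda>u. img u m) ` S) = k" using inj S(2) by (simp add: card_image)
      show "\<not> near d ((\<lambda>u. img u m) ` S) i" unfolding near_def using img_big by (auto simp: not_le Suc_le_eq)
      have "img x m \<noteq> img y m" using inj xy by (auto dest: inj_onD)
      then show "near d ((\<lambda>u. img u m) ` S) (Suc i)" unfolding near_def using xy m by fastforce
    qed
    then show ?thesis by blast
  qed
  have "\<exists>j. near d S j" unfolding near_def
  proof -
    obtain x y where "x \<in> S" "y \<in> S" "x \<noteq> y"
    proof -
      have "\<not> S \<subseteq> {x}" for x using S(2) k card_mono[of "{x}" S] by auto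
      then show thesis using that by (metis subsetI singletonI)
    qed
    then show "\<exists>j. \<exists>x\<in>S. \<exists>y\<in>S. x \<noteq> y \<and> d x y \<le> j" by blast
  qed
  then obtain j where j: "near d S j" "\<forall>i<j. \<not> near d S i" using exists_least_iff[of "near d S"] by blast
  have "j > t + card A" using far j(1) near_mono by (metis not_less)
  then obtain j' where j': "j = Suc j'" "j' \<ge> t + card A" by (cases j) auto
  have top: "P j' S" using j S unfolding P_def j' by auto
  have "\<exists>S'. P i S'" if "i \<le> j'" for i
    using that by (induction rule: inc_induct) (use top descend in blast)+
  then obtain W where W: "P i (W i)" if "i \<le> j'" for i by metis
  have "inj_on W {t..j'}"
  proof (rule inj_onI)
    fix i i' assume "i \<in> {t..j'}" "i' \<in> {t..j'}" "W i = W i'"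
    then have "P i (W i)" "P i' (W i)" using W[of i] W[of i'] by auto
    then show "i = i'" unfolding P_def using near_mono by (metis Suc_leI linorder_neqE_nat)
  qed
  moreover have "W ` {t..j'} \<subseteq> A"
  proof
    fix X assume "X \<in> W ` {t..j'}"
    then obtain i where "i \<in> {t..j'}" "X = W i" by blast
    then have "P i X" "t \<le> i" using W by auto
    then show "X \<in> A" using all near_mono unfolding P_def by blast
  qed
  ultimately have "card {t..j'} \<le> card A" using A by (meson card_inj_on_le)
  then show False using j'(2) by simp
qed

section \<open>Meaning of the bit tables and of the pools of maps\<close>

definition rset :: "row \<Rightarrow> state set" where "rset K = {x. bit x K}"

lemma bit_set_bit [simp]: "bit y (set_bit x z K) \<longleftrightarrow> (if y = x then z else bit y K)"
  by (cases K; cases x; cases y) simp_all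

lemma line_set_row [simp]: "line y (set_row x z T) = (if y = x then z else line y T)"
  by (cases T; cases x; cases y) simp_all

lemma img_set_img [simp]: "img y (set_img x z m) = (if y = x then z else img y m)"
  by (cases m; cases x; cases y) simp_all

lemma bit_no_row [simp]: "\<not> bit x no_row" by (cases x) (simp_all add: no_row_def)

lemma entry_no_table [simp]: "\<not> entry no_table x y" by (cases x) (simp_all add: entry_def no_table_def)

lemma entry_diagonal: "entry diagonal x y \<longleftrightarrow> x = y"
  by (cases x; cases y) (simp_all add: entry_def diagonal_def)

lemma entry_set_entry: "entry (set_entry x y T) u v \<longleftrightarrow> entry T u v \<or> (u = x \<and> v = y)"
  by (auto simp: entry_def set_entry_def)

lemma entry_set_pairs: "entry (set_pairs ps T) u v \<longleftrightarrow> entry T u v \<or> (u, v) \<in> set ps \<or> (v, u) \<in> set ps"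
  by (induction ps T rule: set_pairs.induct) (auto simp: entry_set_entry)

lemma same_iff: "same x y \<longleftrightarrow> x = y" by (cases x; cases y) simp_all

lemma same_pair_iff: "same_pair p q \<longleftrightarrow> p = q" by (cases p; cases q) (simp add: same_iff)

lemma elem_iff: "elem p qs \<longleftrightarrow> p \<in> set qs" by (induction qs) (simp_all add: same_pair_iff)

lemma set_diff_list: "set (diff ps qs) = set ps - set qs" by (induction ps) (auto simp: elem_iff)

lemma join_append: "join xs ys = xs @ ys" by (induction xs) simp_all

lemma trans_eqI: "(\<And>x. img x m = img x m') \<Longrightarrow> m = m'"
proof -
  assume a: "\<And>x. img x m = img x m'"
  show ?thesis using a[of S0] a[of S1] a[of S2] a[of S3] a[of S4] a[of S5] by (cases m; cases m') simp
qed

fun members :: "pool \<Rightarrow> trans set" where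
  "members All = UNIV"
| "members (Few ms) = set ms"
| "members (Br M N) = members M \<union> members N"

lemma members_br [simp]: "members (br M N) = members M \<union> members N"
  by (induction M N rule: br.induct) auto

lemma some_hit_iff: "some_hit T p ms \<longleftrightarrow> (\<exists>m\<in>set ms. hits T p m)" by (induction ms) auto

lemma set_no_hits: "set (no_hits T p ms) = {m \<in> set ms. \<not> hits T p m}" by (induction ms) auto

lemma can_hitI: "m \<in> members M \<Longrightarrow> hits T p m \<Longrightarrow> can_hit T p M"
  by (induction M) (auto simp: some_hit_iff)

lemma members_without: "m \<in> members M \<Longrightarrow> \<not> hits T p m \<Longrightarrow> m \<in> members (without T p M)"
  by (induction M) (auto simp: set_no_hits)

lemma members_withouts: "m \<in> members M \<Longrightarrow> \<forall>p\<in>set ps. \<not> hits T p m \<Longrightarrow> m \<in> members (withouts T ps M)"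
  by (induction ps arbitrary: M) (auto simp: members_without)

lemma all_hitI: "\<forall>p\<in>set ps. \<exists>m\<in>members M. hits T p m \<Longrightarrow> all_hit T ps M"
  by (induction ps) (auto intro: can_hitI)

lemma witnessedI: "\<forall>(ps, T)\<in>set pl. \<forall>p\<in>set ps. \<exists>m\<in>members M. hits T p m \<Longrightarrow> witnessed pl M"
  by (induction pl) (auto intro: all_hitI)

lemma unhitD: "p \<in> set (unhit T ps M) \<Longrightarrow> p \<in> set ps \<and> \<not> can_hit T p M"
  by (induction ps) (auto split: if_splits)

lemma unhitsD: "(ps', T) \<in> set (unhits pl M) \<Longrightarrow> \<exists>ps. (ps, T) \<in> set pl \<and> (\<forall>p\<in>set ps'. p \<in> set ps \<and> \<not> can_hit T p M)"
proof (induction pl)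
  case (Cons a pl)
  obtain qs U where a: "a = (qs, U)" by (cases a)
  show ?case
  proof (cases "ps' = unhit U qs M \<and> T = U")
    case True
    then have "\<forall>p\<in>set ps'. p \<in> set qs \<and> \<not> can_hit T p M" using unhitD by blast
    then show ?thesis using a True by auto
  next
    case False
    then have "(ps', T) \<in> set (unhits pl M)" using Cons.prems a by auto
    then show ?thesis using Cons.IH by auto
  qed
qed simp

lemma hits_one_iff: "hits_one T ps m \<longleftrightarrow> (\<exists>p\<in>set ps. hits T p m)" by (induction ps) auto

lemma set_hitting: "set (hitting T ps ms) = {m \<in> set ms. hits_one T ps m}" by (induction ms) auto

lemma set_missing_all: "set (missing_all T ps ms) = {m \<in> set ms. \<not> hits_one T ps m}" by (induction ms) auto

lemma members_active_neutral: "m \<in> members M \<Longrightarrow> m \<in> members (active T ps M) \<or> m \<in> members (neutral T ps M)"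
  by (induction M) (auto simp: set_hitting set_missing_all)

lemma neutral_misses: "m \<in> members (neutral T ps M) \<Longrightarrow> p \<in> set ps \<Longrightarrow> \<not> hits T p m"
  by (induction M) (auto simp: set_missing_all hits_one_iff)

section \<open>Caps on the distance profile\<close>

lemma covers_iff: "covers K (x, y) \<longleftrightarrow> x \<in> rset K \<and> y \<in> rset K" by (simp add: rset_def)

lemma any_covers_iff: "any_covers Ks p \<longleftrightarrow> (\<exists>K\<in>set Ks. covers K p)" by (induction Ks) auto

lemma set_uncovered: "set (uncovered Ks p) = {K \<in> set Ks. \<not> covers K p}" by (induction Ks) auto

lemma count_eq: "count t xs = t + length xs" by (induction xs arbitrary: t) simp_all

text \<open>A set of size \<open>i + 2\<close> that is not listed contains a pair of distance at most \<open>t\<close>.\<close>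
definition caps :: "state list \<Rightarrow> nat \<Rightarrow> (nat \<times> row list) list \<Rightarrow> (state \<Rightarrow> state \<Rightarrow> nat) \<Rightarrow> bool" where
  "caps vs t un d \<longleftrightarrow> (\<forall>i<length un. \<forall>S. S \<subseteq> set vs \<and> card S = Suc (Suc i) \<longrightarrow>
     near d S (fst (un ! i)) \<and> (near d S t \<or> (\<exists>K\<in>set (snd (un ! i)). rset K = S)))"

lemma caps_mono: "caps vs t un d \<Longrightarrow> t \<le> t' \<Longrightarrow> caps vs t' un d"
  unfolding caps_def by (meson near_mono)

lemma near_capped:
  assumes "cex vs lim d F"
    and "\<And>S. S \<subseteq> set vs \<Longrightarrow> card S = Suc (Suc i) \<Longrightarrow> near d S t \<or> (\<exists>K\<in>set Ks. rset K = S)"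
    and "S \<subseteq> set vs" "card S = Suc (Suc i)"
  shows "near d S (fst (capped t Ks))"
proof -
  have "near d S (t + card (rset ` set Ks))"
    by (rule pigeonhole_cap[OF assms(1) _ _ assms(3,4)]) (use assms(2) in auto)
  moreover have "card (rset ` set Ks) \<le> length Ks"
    by (meson card_image_le card_length finite_set order_trans)
  ultimately show ?thesis by (auto simp: capped_def count_eq intro: near_mono)
qed

lemma length_place [simp]: "length (place t p un) = length un"
  by (induction t p un rule: place.induct) simp_all

lemma place_nth: "i < length un \<Longrightarrow> place t p un ! i =
    (if any_covers (snd (un ! i)) p then capped t (uncovered (snd (un ! i)) p) else un ! i)"
  by (induction t p un arbitrary: i rule: place.induct) (auto simp: nth_Cons split: nat.split)

text \<open>A row is dropped only if the new pair, of distance \<open>t\<close>, lies inside it. So the remaining rows contain all sets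
  without a pair of distance at most \<open>t\<close>, and the pigeonhole bound applies to them.\<close>
lemma caps_place:
  assumes C: "cex vs lim d F" and caps: "caps vs t un d" and p: "x \<noteq> y" "d x y = t"
  shows "caps vs t (place t (x, y) un) d"
  unfolding caps_def
proof (intro allI impI)
  fix i S assume "i < length (place t (x, y) un)" and S: "S \<subseteq> set vs \<and> card S = Suc (Suc i)"
  then have i: "i < length un" by simp
  have old: "near d S' (fst (un ! i)) \<and> (near d S' t \<or> (\<exists>K\<in>set (snd (un ! i)). rset K = S'))"
    if "S' \<subseteq> set vs" "card S' = Suc (Suc i)" for S'
    using caps[unfolded caps_def, rule_format, OF i] that by simp
  have new: "near d S' t \<or> (\<exists>K\<in>set (uncovered (snd (un ! i)) (x, y)). rset K = S')"
    if "S' \<subseteq> set vs" "card S' = Suc (Suc i)" for S'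
  proof (cases "x \<in> S' \<and> y \<in> S'")
    case True
    then show ?thesis using p unfolding near_def by (metis order_refl)
  next
    case False
    then show ?thesis using old[OF that] by (auto simp: set_uncovered covers_iff simp del: covers.simps)
  qed
  show "near d S (fst (place t (x, y) un ! i)) \<and>
      (near d S t \<or> (\<exists>K\<in>set (snd (place t (x, y) un ! i)). rset K = S))"
  proof (cases "any_covers (snd (un ! i)) (x, y)")
    case True
    have "near d S (fst (capped t (uncovered (snd (un ! i)) (x, y))))"
      by (rule near_capped[OF C new]) (use S in auto)
    moreover have "snd (capped t (uncovered (snd (un ! i)) (x, y))) = uncovered (snd (un ! i)) (x, y)"
      by (simp add: capped_def)
    ultimately show ?thesis using True new S by (simp add: place_nth[OF i])
  next
    case False
    then show ?thesis using old S by (simp add: place_nth[OF i])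
  qed
qed

lemma missing_eq: "missing b un = b - sum_list (List.map fst un)"
  by (induction b un rule: missing.induct) simp_all

text \<open>Otherwise greedy merging would give a word of permitted length.\<close>
lemma caps_missing:
  assumes C: "cex vs lim d F" and caps: "caps vs t un d" and len: "Suc (length un) = card (set vs)"
  shows "missing (Suc lim) un = 0"
proof (rule ccontr)
  assume "missing (Suc lim) un \<noteq> 0"
  then have le: "sum_list (List.map fst un) \<le> lim" by (simp add: missing_eq)
  have "collapsible F (\<Sum>k<card (set vs) - Suc 0. fst (un ! k)) (set vs)"
  proof (rule greedy_collapse[OF C, where n = "card (set vs)"])
    show "near d S (fst (un ! k))"
      if "k < card (set vs) - Suc 0" "S \<subseteq> set vs" "card S = Suc (Suc k)" for k S
      using caps that len[symmetric] unfolding caps_def by auto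
    show "set vs \<noteq> {}" using len by (metis card.empty nat.distinct(1))
  qed simp_all
  moreover have "(\<Sum>k<card (set vs) - Suc 0. fst (un ! k)) = sum_list (List.map fst un)"
    using len[symmetric] by (simp add: sum_list_sum_nth atLeast0LessThan)
  ultimately show False using collapsible_mono le cex_not_collapsible[OF C] by metis
qed

lemma subsets_complete:
  "distinct xs \<Longrightarrow> S \<subseteq> set xs \<Longrightarrow> card S = k \<Longrightarrow> \<exists>K\<in>set (subsets k xs). rset K = S"
proof (induction k xs arbitrary: S rule: subsets.induct)
  case (1 xs)
  then have "S = {}" by (metis List.finite_set card_0_eq finite_subset)
  then show ?case by (simp add: rset_def)
next
  case (2 k)
  then show ?case by simp
next
  case (3 k x xs)
  have fin: "finite S" using finite_subset[OF 3(4)] by simp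
  show ?case
  proof (cases "x \<in> S")
    case True
    have "S - {x} \<subseteq> set xs" using 3(4) by auto
    moreover have "card (S - {x}) = k" using 3(5) True fin by simp
    moreover have "distinct xs" using 3(3) by simp
    ultimately obtain K where K: "K \<in> set (subsets k xs)" "rset K = S - {x}" using 3(1) by blast
    then have "rset (set_bit x True K) = S" using True by (auto simp: rset_def)
    then show ?thesis using K(1) by auto
  next
    case False
    then have "S \<subseteq> set xs" using 3(4) by auto
    moreover have "distinct xs" using 3(3) by simp
    ultimately obtain K where "K \<in> set (subsets (Suc k) xs)" "rset K = S" using 3(2,5) by blast
    then show ?thesis by auto
  qed
qed

lemma caps_root:
  assumes C: "cex vs lim d F" and "distinct vs" and ks: "\<forall>i<length ks. ks ! i = Suc (Suc i)"
  shows "caps vs 0 (List.map (\<lambda>k. capped 0 (subsets k vs)) ks) d"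
  unfolding caps_def
proof (intro allI impI)
  fix i S assume i: "i < length (List.map (\<lambda>k. capped 0 (subsets k vs)) ks)"
    and S: "S \<subseteq> set vs \<and> card S = Suc (Suc i)"
  have all: "\<exists>K\<in>set (subsets (Suc (Suc i)) vs). rset K = S'" if "S' \<subseteq> set vs" "card S' = Suc (Suc i)" for S'
    using subsets_complete[OF assms(2) that] .
  have "near d S (fst (capped 0 (subsets (Suc (Suc i)) vs)))"
    by (rule near_capped[OF C]) (use all S in auto)
  moreover have "snd (capped 0 (subsets (Suc (Suc i)) vs)) = subsets (Suc (Suc i)) vs" by (simp add: capped_def)
  ultimately show "near d S (fst (List.map (\<lambda>k. capped 0 (subsets k vs)) ks ! i)) \<and>
      (near d S 0 \<or> (\<exists>K\<in>set (snd (List.map (\<lambda>k. capped 0 (subsets k vs)) ks ! i)). rset K = S))"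
    using ks i all S by simp
qed

section \<open>Generating the maps compatible with the first level\<close>

lemma fitsI: "\<forall>y\<in>set ys. v = img y m \<longrightarrow> entry T x y \<Longrightarrow> fits T m x v ys"
  by (induction ys) (auto simp: same_iff)

lemma members_foldr_br: "v \<in> set ws \<Longrightarrow> m \<in> members (f v) \<Longrightarrow> m \<in> members (foldr (\<lambda>v. br (f v)) ws N)"
  by (induction ws) auto

lemma set_foldr_if: "v \<in> set ws \<Longrightarrow> P v \<Longrightarrow> f v \<in> set (foldr (\<lambda>v ms. if P v then f v # ms else ms) ws [])"
  by (induction ws) auto

text \<open>The map \<open>m\<close> survives every choice: at each state, its own image is one of the options, and it merges only pairs of
  \<open>T\<close>.\<close>
lemma extend_complete:
  assumes closed: "\<And>x. x \<in> set vs \<Longrightarrow> img x m \<in> set vs"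
    and compat: "\<And>x y. x \<in> set vs \<Longrightarrow> y \<in> set vs \<Longrightarrow> x \<noteq> y \<Longrightarrow> img x m = img y m \<Longrightarrow> entry T x y"
  shows "distinct xs \<Longrightarrow> set xs \<subseteq> set vs \<Longrightarrow> set ys \<subseteq> set vs \<Longrightarrow> set xs \<inter> set ys = {} \<Longrightarrow>
    (\<And>x. x \<notin> set xs \<Longrightarrow> img x m0 = img x m) \<Longrightarrow> m \<in> members (extend T vs xs ys m0)"
proof (induction xs arbitrary: ys m0)
  case Nil
  then have "m = m0" by (intro trans_eqI) simp
  then show ?case by simp
next
  case step: (Cons x xs)
  let ?v = "img x m" and ?m = "set_img x (img x m) m0"
  have v: "?v \<in> set vs" using closed step.prems(2) by simp
  have fit: "fits T m0 x ?v ys"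
  proof (rule fitsI, intro ballI impI)
    fix y assume y: "y \<in> set ys" "?v = img y m0"
    then have "y \<notin> set (x # xs)" using step.prems(4) by auto
    then have "img y m0 = img y m" "y \<noteq> x" using step.prems(5) by auto
    then show "entry T x y" using compat[of x y] y step.prems by auto
  qed
  show ?case
  proof (cases xs)
    case Nil
    then have "m = ?m" using step.prems(5) by (intro trans_eqI) auto
    moreover have "?m \<in> set (foldr (\<lambda>v ms. if fits T m0 x v ys then set_img x v m0 # ms else ms) vs [])"
      using set_foldr_if[of ?v vs "\<lambda>v. fits T m0 x v ys" "\<lambda>v. set_img x v m0"] v fit by simp
    ultimately show ?thesis using Nil by simp
  next
    case (Cons x' xs')
    have "m \<in> members (extend T vs xs (x # ys) ?m)"
      by (rule step.IH) (use step.prems in auto)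
    then have "m \<in> members ((\<lambda>v. if fits T m0 x v ys then extend T vs (x' # xs') (x # ys) (set_img x v m0) else Few []) ?v)"
      using fit Cons by simp
    from members_foldr_br[where f = "\<lambda>v. if fits T m0 x v ys then extend T vs (x' # xs') (x # ys) (set_img x v m0) else Few []", OF v this] show ?thesis using Cons by simp
  qed
qed

section \<open>Distance levels and their symmetries\<close>

definition dist :: "(state \<Rightarrow> state \<Rightarrow> nat) \<Rightarrow> pair \<Rightarrow> nat" where "dist d p = d (fst p) (snd p)"

text \<open>The levels are numbered from one, and the latest comes first. The statement is about the level sets
  only, so it is invariant under symmetries of these sets; the tables are treated by \<open>tabs\<close>.\<close>
fun levs :: "state list \<Rightarrow> (pair list \<times> table) list \<Rightarrow> (state \<Rightarrow> state \<Rightarrow> nat) \<Rightarrow> bool" where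
  "levs vs [] d = True"
| "levs vs ((ps, T) # pl) d =
    ((\<forall>p\<in>set (pairs vs). p \<in> set ps \<longleftrightarrow> dist d p = Suc (length pl)) \<and> levs vs pl d)"

definition table_ok :: "state list \<Rightarrow> table \<Rightarrow> nat \<Rightarrow> (state \<Rightarrow> state \<Rightarrow> nat) \<Rightarrow> bool" where
  "table_ok vs T t d \<longleftrightarrow> (\<forall>x\<in>set vs. \<forall>y\<in>set vs. entry T x y \<longleftrightarrow> d x y = t)"

fun tabs :: "state list \<Rightarrow> (pair list \<times> table) list \<Rightarrow> (state \<Rightarrow> state \<Rightarrow> nat) \<Rightarrow> bool" where
  "tabs vs [] d = True"
| "tabs vs ((ps, T) # pl) d = (table_ok vs T (length pl) d \<and> tabs vs pl d)"

text \<open>The part of the invariant that does not depend on the counterexample.\<close>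
definition shape :: "state list \<Rightarrow> (pair list \<times> table) list \<Rightarrow> pair list \<Rightarrow> pair list \<Rightarrow> bool" where
  "shape vs pl und sy \<longleftrightarrow> (\<forall>(ps, T)\<in>set pl. set ps \<subseteq> set (pairs vs)) \<and> set und \<subseteq> set (pairs vs) \<and>
    (\<forall>s\<in>set sy. fst s \<in> set vs \<and> snd s \<in> set vs \<and> (\<forall>(ps, T)\<in>set pl. \<forall>p\<in>set ps. swap_pair s p \<in> set ps))"

text \<open>The undecided pairs are exactly those of larger distance than the determined levels.\<close>
definition facts :: "state list \<Rightarrow> (pair list \<times> table) list \<Rightarrow> table \<Rightarrow> pair list \<Rightarrow> (state \<Rightarrow> state \<Rightarrow> nat) \<Rightarrow> bool" where
  "facts vs pl T und d \<longleftrightarrow> table_ok vs T (length pl) d \<and> tabs vs pl d \<and>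
    (\<forall>p\<in>set und. length pl < dist d p) \<and> (\<forall>p\<in>set (pairs vs). length pl < dist d p \<longrightarrow> p \<in> set und)"

text \<open>The invariant of the search. It quantifies over all counterexamples with the given levels, rather than
  following a single one, since the symmetry argument replaces a counterexample by a relabelled one.\<close>
fun good :: "state list \<Rightarrow> nat \<Rightarrow> node \<Rightarrow> bool" where
  "good vs lim (Node t T pl und M un sy) \<longleftrightarrow> t = Suc (length pl) \<and> shape vs pl und sy \<and>
    Suc (length un) = card (set vs) \<and> (\<forall>d F. cex vs lim d F \<and> levs vs pl d \<longrightarrow>
      facts vs pl T und d \<and> F \<subseteq> members M \<and> caps vs t un d)"

fun realised :: "state list \<Rightarrow> nat \<Rightarrow> node \<Rightarrow> bool" where
  "realised vs lim (Node t T pl und M un sy) \<longleftrightarrow> (\<exists>d F. cex vs lim d F \<and> levs vs pl d)"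

text \<open>Relabelling by \<open>s\<close> turns counterexamples with property \<open>L\<close> into such counterexamples. Speaking of the effect
  on counterexamples makes closure under composition immediate.\<close>
definition sym_of where
  "sym_of vs lim L s \<longleftrightarrow> (\<forall>d F. cex vs lim d F \<and> L d \<longrightarrow>
    (\<exists>F'. cex vs lim (\<lambda>x y. d (s x) (s y)) F') \<and> L (\<lambda>x y. d (s x) (s y)))"

text \<open>\<open>q\<close> is the image of \<open>p\<close> under a relabelling, up to the order of the two states.\<close>
definition related where
  "related vs lim L p q \<longleftrightarrow> q \<in> set (pairs vs) \<and> (\<exists>s. sym_of vs lim L s \<and>
    (\<forall>d. (\<forall>x y. d x y = d y x) \<longrightarrow> dist d q = d (s (fst p)) (s (snd p))))"

lemma before_total: "x \<noteq> y \<Longrightarrow> before x y \<or> before y x" by (cases x; cases y) simp_all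

lemma before_asym: "before x y \<Longrightarrow> \<not> before y x" by (cases x; cases y) simp_all

lemma before_neq: "before x y \<Longrightarrow> x \<noteq> y" by (cases x; cases y) simp_all

lemma swap_simp: "swap (u, v) x = (if x = u then v else if x = v then u else x)" by (simp add: same_iff)

lemma swap_swap [simp]: "swap s (swap s x) = x" by (cases s) (simp add: swap_simp del: swap.simps)

lemma swap_in: "fst s \<in> V \<Longrightarrow> snd s \<in> V \<Longrightarrow> x \<in> V \<Longrightarrow> swap s x \<in> V"
  by (cases s) (simp add: swap_simp del: swap.simps)

lemma swap_eq [simp]: "swap s x = swap s y \<longleftrightarrow> x = y" by (metis swap_swap)

lemma dist_swap: "\<forall>x y. d x y = d y x \<Longrightarrow> dist d (swap_pair s p) = d (swap s (fst p)) (swap s (snd p))"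
  by (cases p) (simp add: dist_def del: swap.simps)

definition trans_of :: "(state \<Rightarrow> state) \<Rightarrow> trans" where
  "trans_of f = Trans (f S0) (f S1) (f S2) (f S3) (f S4) (f S5)"

lemma img_trans_of [simp]: "img x (trans_of f) = f x" by (cases x) (simp_all add: trans_of_def)

text \<open>The letters of the relabelled counterexample are the conjugates by the transposition, and a reset word over them is the
  conjugate of a reset word.\<close>
lemma cex_swap:
  assumes C: "cex vs lim d F" and s: "fst s \<in> set vs" "snd s \<in> set vs"
  shows "\<exists>F'. cex vs lim (\<lambda>x y. d (swap s x) (swap s y)) F'"
proof -
  let ?c = "\<lambda>m. trans_of (\<lambda>x. if x \<in> set vs then swap s (img (swap s x) m) else S0)"
  note sw = swap_in[OF s]
  have word: "x \<in> set vs \<Longrightarrow> act (List.map ?c w) x = swap s (act w (swap s x))" if "set w \<subseteq> F" for w x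
    using that by (induction w arbitrary: x) (use sw cex_closed[OF C] in auto)
  have "\<not> collapsible (?c ` F) lim (set vs)"
  proof
    assume "collapsible (?c ` F) lim (set vs)"
    then obtain w' z where w': "set w' \<subseteq> ?c ` F" "length w' \<le> lim" "act w' ` set vs = {z}"
      unfolding collapsible_def by blast
    then have "w' \<in> lists (?c ` F)" by auto
    then obtain w where w: "w' = List.map ?c w" "set w \<subseteq> F" unfolding lists_image by auto
    have "act w x = swap s z" if "x \<in> set vs" for x
    proof -
      have "act w' (swap s x) = z" using w'(3) sw that by blast
      then show ?thesis using word[OF w(2) sw[OF that]] w(1) by (metis swap_swap)
    qed
    then have "act w ` set vs = (\<lambda>x. swap s z) ` set vs" by (intro image_cong) auto
    moreover have "set vs \<noteq> {}" using w'(3) by auto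
    ultimately have "act w ` set vs = {swap s z}" by (simp add: image_constant_conv)
    then show False using cex_not_collapsible[OF C] w w'(2) unfolding collapsible_def by auto
  qed
  moreover have "\<exists>m\<in>?c ` F. d (swap s x) (swap s y) = Suc (d (swap s (img x m)) (swap s (img y m)))"
    if "x \<in> set vs" "y \<in> set vs" "x \<noteq> y" for x y
    using cex_witness[OF C sw[OF that(1)] sw[OF that(2)]] that by auto
  ultimately have "cex vs lim (\<lambda>x y. d (swap s x) (swap s y)) (?c ` F)"
    unfolding cex_def using cex_sym[OF C] cex_zero[OF C] cex_closed[OF C] cex_step[OF C] sw by auto
  then show ?thesis by blast
qed

lemma set_symmetries: "set (symmetries qs sy) = {s \<in> set sy. \<forall>q\<in>set qs. swap_pair s q \<in> set qs}"
proof -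
  have "maps_into s qs ps \<longleftrightarrow> (\<forall>p\<in>set ps. swap_pair s p \<in> set qs)" for s ps
    by (induction ps) (auto simp: elem_iff)
  then show ?thesis by (induction sy) auto
qed

lemma add_images_subset: "set acc \<subseteq> set (add_images sy acc p)"
proof (induction sy arbitrary: acc)
  case (Cons s sy)
  from Cons[of "swap_pair s p # acc"] Cons[of acc] show ?case by auto
qed simp

lemma add_all_images_subset: "set acc \<subseteq> set (add_all_images sy acc ps)"
  by (induction ps arbitrary: acc) (use add_images_subset in fastforce)+

lemma add_images_closed:
  "\<forall>q\<in>set acc. R q \<Longrightarrow> \<forall>s\<in>set sy. R (swap_pair s p) \<Longrightarrow> q \<in> set (add_images sy acc p) \<Longrightarrow> R q"
proof (induction sy arbitrary: acc)
  case (Cons s sy)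
  show ?case
  proof (cases "elem (swap_pair s p) acc")
    case True
    then show ?thesis using Cons.IH[of acc] Cons.prems by simp
  next
    case False
    then show ?thesis using Cons.IH[of "swap_pair s p # acc"] Cons.prems by simp
  qed
qed simp

lemma add_all_images_closed:
  "\<forall>q\<in>set acc. R q \<Longrightarrow> \<forall>p\<in>set ps. R p \<Longrightarrow> (\<And>s p. s \<in> set sy \<Longrightarrow> R p \<Longrightarrow> R (swap_pair s p)) \<Longrightarrow>
    q \<in> set (add_all_images sy acc ps) \<Longrightarrow> R q"
proof (induction ps arbitrary: acc)
  case (Cons p ps)
  have "\<forall>q\<in>set (add_images sy acc p). R q"
    using add_images_closed[of acc R sy p] Cons.prems by auto
  then show ?case using Cons.IH[of "add_images sy acc p"] Cons.prems by auto
qed simp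

lemma orbit_self: "p \<in> set (orbit sy p)"
proof (cases sy)
  case (Cons s sy')
  have "p \<in> set (add_images sy [p] p)" using add_images_subset[of "[p]"] by auto
  then show ?thesis using add_all_images_subset[of "add_images sy [p] p" sy "add_images sy [p] p"] Cons by auto
qed simp

lemma orbit_closed:
  assumes "R p" and step: "\<And>s p. s \<in> set sy \<Longrightarrow> R p \<Longrightarrow> R (swap_pair s p)" and "q \<in> set (orbit sy p)"
  shows "R q"
proof (cases sy)
  case Nil
  then show ?thesis using assms by simp
next
  case (Cons s sy')
  have one: "\<forall>q\<in>set (add_images sy [p] p). R q"
    using add_images_closed[of "[p]" R sy p] assms(1) step by auto
  have "q \<in> set (add_all_images sy (add_images sy [p] p) (add_images sy [p] p))"
    using assms(3) unfolding Cons by (simp only: orbit.simps)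
  then show ?thesis using add_all_images_closed[OF one one step] by blast
qed

locale search_space =
  fixes vs :: "state list" and lim :: nat
  assumes pairs_vs: "set (pairs vs) = {(x, y). x \<in> set vs \<and> y \<in> set vs \<and> before x y}"
    and distinct_vs: "distinct vs"
begin

lemma in_pairs: "(x, y) \<in> set (pairs vs) \<longleftrightarrow> x \<in> set vs \<and> y \<in> set vs \<and> before x y"
  by (simp add: pairs_vs)

lemma pairs_cases: "x \<in> set vs \<Longrightarrow> y \<in> set vs \<Longrightarrow> x \<noteq> y \<Longrightarrow> (x, y) \<in> set (pairs vs) \<or> (y, x) \<in> set (pairs vs)"
  using before_total in_pairs by blast

lemma swap_pair_in:
  assumes "fst s \<in> set vs" "snd s \<in> set vs" "p \<in> set (pairs vs)"
  shows "swap_pair s p \<in> set (pairs vs)"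
proof -
  obtain x y where p: "p = (x, y)" by (cases p)
  then have "x \<in> set vs" "y \<in> set vs" "x \<noteq> y" using assms(3) in_pairs before_neq by auto
  then have "swap s x \<in> set vs" "swap s y \<in> set vs" "swap s x \<noteq> swap s y"
    using swap_in[OF assms(1,2)] by auto
  then show ?thesis using p before_total[of "swap s x" "swap s y"] by (auto simp: in_pairs simp del: swap.simps)
qed

lemma swap_pair_swap_pair: "p \<in> set (pairs vs) \<Longrightarrow> swap_pair s (swap_pair s p) = p"
  using before_asym by (cases p) (auto simp: in_pairs simp del: swap.simps)

text \<open>Transpositions are involutions, so one that maps a level into itself permutes it.\<close>
lemma levs_swap:
  assumes d: "\<forall>x y. d x y = d y x" and s: "fst s \<in> set vs" "snd s \<in> set vs"
  shows "\<forall>(ps, T)\<in>set pl. \<forall>p\<in>set ps. swap_pair s p \<in> set ps \<Longrightarrow> levs vs pl d \<Longrightarrow>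
    levs vs pl (\<lambda>x y. d (swap s x) (swap s y))"
proof (induction pl)
  case (Cons a pl)
  obtain ps T where a: "a = (ps, T)" by (cases a)
  have lev: "q \<in> set ps \<longleftrightarrow> dist d q = Suc (length pl)" if "q \<in> set (pairs vs)" for q
    using Cons.prems(2) a that by simp
  have cl: "swap_pair s q \<in> set ps" if "q \<in> set ps" for q using Cons.prems(1) a that by simp
  have "p \<in> set ps \<longleftrightarrow> dist (\<lambda>x y. d (swap s x) (swap s y)) p = Suc (length pl)"
    if p: "p \<in> set (pairs vs)" for p
  proof -
    have "dist (\<lambda>x y. d (swap s x) (swap s y)) p = dist d (swap_pair s p)"
      using dist_swap[OF d] by (simp add: dist_def)
    moreover have "swap_pair s p \<in> set ps \<longleftrightarrow> p \<in> set ps"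
      using cl swap_pair_swap_pair[OF p] by metis
    ultimately show ?thesis using lev[OF swap_pair_in[OF s p]] by simp
  qed
  then show ?case using Cons a by simp
qed simp

lemma related_refl: "p \<in> set (pairs vs) \<Longrightarrow> related vs lim L p p"
  unfolding related_def sym_of_def by (auto intro!: exI[of _ "\<lambda>x. x"] simp: dist_def)

lemma related_swap:
  assumes r: "related vs lim L p q" and s: "sym_of vs lim L (swap s)" "fst s \<in> set vs" "snd s \<in> set vs"
  shows "related vs lim L p (swap_pair s q)"
proof -
  obtain f where f: "sym_of vs lim L f" "\<And>d. \<forall>x y. d x y = d y x \<Longrightarrow> dist d q = d (f (fst p)) (f (snd p))"
    and q: "q \<in> set (pairs vs)" using r unfolding related_def by blast
  have "sym_of vs lim L (\<lambda>x. swap s (f x))" unfolding sym_of_def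
  proof (intro allI impI)
    fix d F assume "cex vs lim d F \<and> L d"
    then obtain F' where F': "cex vs lim (\<lambda>x y. d (swap s x) (swap s y)) F'" "L (\<lambda>x y. d (swap s x) (swap s y))"
      using s(1) unfolding sym_of_def by blast
    then show "(\<exists>F'. cex vs lim (\<lambda>x y. d (swap s (f x)) (swap s (f y))) F') \<and> L (\<lambda>x y. d (swap s (f x)) (swap s (f y)))"
      using f(1)[unfolded sym_of_def, rule_format, OF conjI, OF F'] by simp
  qed
  moreover have "dist d (swap_pair s q) = d (swap s (f (fst p))) (swap s (f (snd p)))"
    if "\<forall>x y. d x y = d y x" for d
    using dist_swap[OF that] f(2)[of "\<lambda>x y. d (swap s x) (swap s y)"] that by (simp add: dist_def)
  ultimately show ?thesis using swap_pair_in[OF s(2,3) q] unfolding related_def by blast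
qed

lemma witness_hits:
  assumes C: "cex vs lim d F" and p: "p \<in> set (pairs vs)" and T: "table_ok vs T k d" and k: "dist d p = Suc k"
  shows "\<exists>m\<in>F. hits T p m"
proof -
  obtain x y where xy: "p = (x, y)" by (cases p)
  then have V: "x \<in> set vs" "y \<in> set vs" "x \<noteq> y" using p in_pairs before_neq by auto
  obtain m where m: "m \<in> F" "d x y = Suc (d (img x m) (img y m))" using cex_witness[OF C V] by blast
  then have "d (img x m) (img y m) = k" using k xy by (simp add: dist_def)
  then have "hits T p m" using T cex_closed[OF C m(1)] V xy by (simp add: hits_def table_ok_def)
  then show ?thesis using m(1) by blast
qed

lemma levs_witness:
  assumes C: "cex vs lim d F" and "levs vs pl d" "tabs vs pl d" "(ps, T) \<in> set pl" "p \<in> set ps" "p \<in> set (pairs vs)"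
  shows "\<exists>m\<in>F. hits T p m"
  using assms(2-6)
proof (induction pl)
  case (Cons a pl)
  obtain qs U where a: "a = (qs, U)" by (cases a)
  show ?case
  proof (cases "ps = qs \<and> T = U")
    case True
    then show ?thesis using witness_hits[OF C, of p T "length pl"] Cons.prems a by simp
  next
    case False
    then show ?thesis using Cons a by auto
  qed
qed simp

text \<open>A letter lowers distances by at most one, so it sends no pair of distance above \<open>t\<close> into level \<open>t - 1\<close>. This is
  what justifies the removal of maps from the pool.\<close>
lemma far_misses:
  assumes C: "cex vs lim d F" and f: "facts vs pl T und d" and q: "q \<in> set (pairs vs)"
    and far: "length pl < dist d q" "dist d q \<noteq> Suc (length pl)" and m: "m \<in> F"
  shows "\<not> hits T q m"
proof
  assume h: "hits T q m"
  obtain x y where xy: "q = (x, y)" by (cases q)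
  then have V: "x \<in> set vs" "y \<in> set vs" using q in_pairs by auto
  have "d (img x m) (img y m) = length pl"
    using f h xy cex_closed[OF C m] V unfolding facts_def table_ok_def hits_def by auto
  then have "d x y \<le> Suc (length pl)" using cex_step[OF C m V] by simp
  then show False using far xy by (simp add: dist_def)
qed

text \<open>Witnesses lower the distance in steps of one, so there is no gap below an occupied level.\<close>
lemma level_inhabited:
  assumes C: "cex vs lim d F" and t: "0 < t"
  shows "p \<in> set (pairs vs) \<Longrightarrow> t \<le> dist d p \<Longrightarrow> \<exists>q\<in>set (pairs vs). dist d q = t"
proof (induction "dist d p" arbitrary: p rule: less_induct)
  case less
  show ?case
  proof (cases "dist d p = t")
    case False
    obtain x y where xy: "p = (x, y)" by (cases p)
    then have V: "x \<in> set vs" "y \<in> set vs" "x \<noteq> y" using less.prems in_pairs before_neq by auto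
    obtain m where m: "m \<in> F" "d x y = Suc (d (img x m) (img y m))" using cex_witness[OF C V] by blast
    have e: "Suc (d (img x m) (img y m)) = dist d p" using m xy by (simp add: dist_def)
    then have ge: "t \<le> d (img x m) (img y m)" using False less.prems(2) by simp
    then have "img x m \<noteq> img y m" using t cex_zero[OF C] cex_closed[OF C m(1)] V by force
    then obtain q where q: "q \<in> set (pairs vs)" "q = (img x m, img y m) \<or> q = (img y m, img x m)"
      using pairs_cases cex_closed[OF C m(1)] V by blast
    then have "dist d q = d (img x m) (img y m)" using cex_sym[OF C] by (auto simp: dist_def)
    then show ?thesis using less.hyps[of q] q(1) e ge by simp
  qed (use less.prems in blast)
qed
end

section \<open>Correctness of the level search\<close>

text \<open>The partial decisions within the level \<open>length pl + 1\<close>.\<close>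
definition lay where
  "lay vs pl ins outs d \<longleftrightarrow> levs vs pl d \<and> (\<forall>p\<in>set ins. dist d p = Suc (length pl)) \<and>
    (\<forall>p\<in>set outs. dist d p \<noteq> Suc (length pl))"

context search_space
begin

lemma sym_of_swap:
  assumes sh: "shape vs pl und sy" and s: "s \<in> set (symmetries outs (symmetries ins sy))"
  shows "sym_of vs lim (lay vs pl ins outs) (swap s)"
  unfolding sym_of_def
proof (intro allI impI)
  fix d F assume a: "cex vs lim d F \<and> lay vs pl ins outs d"
  then have C: "cex vs lim d F" by blast
  have sym: "\<forall>x y. d x y = d y x" using cex_sym[OF C] by blast
  have sy: "s \<in> set sy" "\<forall>p\<in>set ins. swap_pair s p \<in> set ins" "\<forall>p\<in>set outs. swap_pair s p \<in> set outs"
    using s by (auto simp: set_symmetries simp del: swap_pair.simps)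
  then have V: "fst s \<in> set vs" "snd s \<in> set vs" and cl: "\<forall>(ps, T)\<in>set pl. \<forall>p\<in>set ps. swap_pair s p \<in> set ps"
    using sh unfolding shape_def by blast+
  have eq: "dist (\<lambda>x y. d (swap s x) (swap s y)) p = dist d (swap_pair s p)" for p
    using dist_swap[OF sym] by (simp add: dist_def)
  have "lay vs pl ins outs (\<lambda>x y. d (swap s x) (swap s y))"
    using a levs_swap[OF sym V cl] sy(2,3) unfolding lay_def eq by blast
  then show "(\<exists>F'. cex vs lim (\<lambda>x y. d (swap s x) (swap s y)) F') \<and> lay vs pl ins outs (\<lambda>x y. d (swap s x) (swap s y))"
    using cex_swap[OF C V] by blast
qed

lemma orbit_related:
  assumes sh: "shape vs pl und sy" and p: "p \<in> set (pairs vs)"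
    and q: "q \<in> set (orbit (symmetries outs (symmetries ins sy)) p)"
  shows "related vs lim (lay vs pl ins outs) p q"
proof (rule orbit_closed[where R = "related vs lim (lay vs pl ins outs) p", OF related_refl[OF p] _ q])
  fix s q assume s: "s \<in> set (symmetries outs (symmetries ins sy))" and r: "related vs lim (lay vs pl ins outs) p q"
  then have "s \<in> set sy" by (simp add: set_symmetries)
  then show "related vs lim (lay vs pl ins outs) p (swap_pair s q)"
    using related_swap[OF r sym_of_swap[OF sh s]] sh unfolding shape_def by blast
qed

text \<open>If some counterexample agrees with the decisions made so far, then one of the resulting nodes belongs to a
  counterexample. If no counterexample has \<open>p\<close> in the level, then none has a member of the orbit of \<open>p\<close> in it: relabelling
  would move that member to \<open>p\<close>. The hypothesis on \<open>us\<close> says that its pairs are placed pairs without a witness in the part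
  \<open>ns\<close> of the pool that was set aside.\<close>
lemma layer_sound:
  assumes sh: "shape vs pl und sy" and t: "t = Suc (length pl)" and und: "und \<noteq> []"
    and facts: "\<And>d F. cex vs lim d F \<Longrightarrow> levs vs pl d \<Longrightarrow> facts vs pl T und d"
    and neutral: "\<And>m p. m \<in> members ns \<Longrightarrow> p \<in> set und \<Longrightarrow> \<not> hits T p m"
    and us: "\<And>ps' T'. (ps', T') \<in> set us \<Longrightarrow>
      \<exists>ps. (ps, T') \<in> set pl \<and> (\<forall>p\<in>set ps'. p \<in> set ps \<and> (\<forall>m\<in>members ns. \<not> hits T' p m))"
  shows "cex vs lim d F \<Longrightarrow> lay vs pl ins outs d \<Longrightarrow> set ps \<subseteq> set und \<Longrightarrow> set ins \<subseteq> set und \<Longrightarrow>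
    set outs \<subseteq> set (pairs vs) \<Longrightarrow> set skip \<subseteq> set outs \<Longrightarrow> set und \<subseteq> set ins \<union> set outs \<union> set ps \<Longrightarrow>
    Suc (length un) = card (set vs) \<Longrightarrow>
    (\<And>d F. cex vs lim d F \<Longrightarrow> lay vs pl ins outs d \<Longrightarrow> F \<subseteq> members M \<union> members ns \<and> caps vs t un d) \<Longrightarrow>
    \<exists>nd\<in>set (layer (Suc lim) t T pl us und sy ns un outs skip ins M ps). good vs lim nd \<and> realised vs lim nd"
proof (induction ps arbitrary: d F un outs skip ins M)
  case Nil
  note C = Nil.prems(1) and L = Nil.prems(2)
  have undP: "set und \<subseteq> set (pairs vs)" using sh unfolding shape_def by blast
  have F0: "facts vs pl T und d" using facts[OF C] L unfolding lay_def by blast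
  \<comment> \<open>Without this, counterexamples of the new node might violate the exclusions by which the pool was filtered.\<close>
  have disj: "q \<notin> set ins" if "q \<in> set outs" for q using that L unfolding lay_def by blast
  have ins_iff: "p \<in> set ins \<longleftrightarrow> dist d p = t" if p: "p \<in> set (pairs vs)" for p
  proof
    assume "dist d p = t"
    then have "p \<in> set und" using F0 p t unfolding facts_def by simp
    then show "p \<in> set ins" using Nil.prems(7) L \<open>dist d p = t\<close> t unfolding lay_def by auto
  qed (use L t in \<open>simp add: lay_def\<close>)
  have ne: "ins \<noteq> []"
  proof -
    obtain p where "p \<in> set und" using und by (cases und) auto
    then have "p \<in> set (pairs vs)" "t \<le> dist d p" using undP F0 t unfolding facts_def by auto
    then obtain q where "q \<in> set (pairs vs)" "dist d q = t" using level_inhabited[OF C] t by blast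
    then show ?thesis using ins_iff by (metis empty_iff list.set(1))
  qed
  let ?nd = "child t T pl und sy ns ins M un"
  have "realised vs lim ?nd" unfolding child_def
    using C L ins_iff t by (auto simp: lay_def)
  moreover have "good vs lim ?nd" unfolding child_def good.simps
  proof (intro conjI allI impI)
    show "Suc t = Suc (length ((ins, T) # pl))" using t by simp
    show "shape vs ((ins, T) # pl) (diff und ins) (symmetries ins sy)"
      using sh Nil.prems(4) undP unfolding shape_def by (auto simp: set_symmetries set_diff_list simp del: swap_pair.simps)
    show "Suc (length un) = card (set vs)" by (rule Nil.prems(8))
    fix d F assume "cex vs lim d F \<and> levs vs ((ins, T) # pl) d"
    then have C: "cex vs lim d F" and lv: "levs vs pl d"
      and it: "p \<in> set (pairs vs) \<Longrightarrow> p \<in> set ins \<longleftrightarrow> dist d p = t" for p using t by auto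
    have lay: "lay vs pl ins outs d" unfolding lay_def
      using lv it t disj undP Nil.prems(4,5) by (metis subsetD)
    have fx: "facts vs pl T und d" using facts[OF C lv] .
    have tab: "table_ok vs (set_pairs ins no_table) t d" unfolding table_ok_def
    proof (intro ballI)
      fix x y assume xy: "x \<in> set vs" "y \<in> set vs"
      show "entry (set_pairs ins no_table) x y \<longleftrightarrow> d x y = t"
      proof (cases "x = y")
        case True
        have "(x, x) \<notin> set ins" using Nil.prems(4) undP before_neq in_pairs by blast
        moreover have "d x x \<noteq> t" using cex_zero[OF C xy(1) xy(1)] t by simp
        ultimately show ?thesis using True by (simp add: entry_set_pairs)
      next
        case False
        have sub: "set ins \<subseteq> set (pairs vs)" using Nil.prems(4) undP by blast
        have eqs: "(x, y) \<in> set (pairs vs) \<Longrightarrow> (x, y) \<in> set ins \<longleftrightarrow> d x y = t"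
          "(y, x) \<in> set (pairs vs) \<Longrightarrow> (y, x) \<in> set ins \<longleftrightarrow> d x y = t"
          using it[of "(x, y)"] it[of "(y, x)"] cex_sym[OF C, of x y] by (auto simp: dist_def)
        have "\<not> ((x, y) \<in> set (pairs vs) \<and> (y, x) \<in> set (pairs vs))" using before_asym in_pairs by blast
        then have "(x, y) \<in> set ins \<or> (y, x) \<in> set ins \<longleftrightarrow> d x y = t"
          using pairs_cases[OF xy False] eqs sub by blast
        then show ?thesis by (simp add: entry_set_pairs)
      qed
    qed
    show "facts vs ((ins, T) # pl) (set_pairs ins no_table) (diff und ins) d" unfolding facts_def
    proof (intro conjI ballI impI)
      show "table_ok vs (set_pairs ins no_table) (length ((ins, T) # pl)) d" using tab t by simp
      show "tabs vs ((ins, T) # pl) d" using fx unfolding facts_def by simp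
      show "length ((ins, T) # pl) < dist d p" if "p \<in> set (diff und ins)" for p
      proof -
        have "p \<in> set und" "p \<notin> set ins" using that by (auto simp: set_diff_list)
        then have "length pl < dist d p" "dist d p \<noteq> t" using fx it undP unfolding facts_def by blast+
        then show ?thesis using t by simp
      qed
      show "p \<in> set (diff und ins)" if "p \<in> set (pairs vs)" "length ((ins, T) # pl) < dist d p" for p
        using that fx it[OF that(1)] t unfolding facts_def by (auto simp: set_diff_list)
    qed
    show "F \<subseteq> members (br ns M)" using Nil.prems(9)[OF C lay] by auto
    show "caps vs (Suc t) un d" using Nil.prems(9)[OF C lay] caps_mono by (meson le_SucI order_refl)
  qed
  ultimately show ?case using ne by (cases ins) auto
next
  case (Cons p ps)
  note C = Cons.prems(1) and L = Cons.prems(2) and inv = Cons.prems(9)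
  have undP: "set und \<subseteq> set (pairs vs)" using sh unfolding shape_def by blast
  have p: "p \<in> set und" "p \<in> set (pairs vs)" using Cons.prems(3) undP by auto
  have lay_levs: "levs vs pl d" if "lay vs pl ins outs d" for d ins outs using that unfolding lay_def by blast
  have viable: "viable T us ins M'"
    if C: "cex vs lim d F" and L: "lay vs pl ins outs' d" and M': "F \<subseteq> members M' \<union> members ns" for d F outs' M'
  proof -
    have fx: "facts vs pl T und d" using facts[OF C lay_levs[OF L]] .
    have "\<exists>m\<in>members M'. hits T q m" if q: "q \<in> set ins" for q
    proof -
      have "q \<in> set und" using q Cons.prems(4) by blast
      moreover obtain m where "m \<in> F" "hits T q m"
        using witness_hits[OF C, of q T "length pl"] fx L q calculation undP unfolding facts_def lay_def by blast
      ultimately show ?thesis using M' neutral by blast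
    qed
    moreover have "\<exists>m\<in>members M'. hits T' q m" if u: "(ps', T') \<in> set us" and q: "q \<in> set ps'" for ps' T' q
    proof -
      obtain qs where qs: "(qs, T') \<in> set pl" "q \<in> set qs" "\<forall>m\<in>members ns. \<not> hits T' q m" using us[OF u] q by blast
      moreover have "q \<in> set (pairs vs)" using sh qs unfolding shape_def by blast
      moreover obtain m where "m \<in> F" "hits T' q m"
        using levs_witness[OF C lay_levs[OF L] _ qs(1,2)] fx calculation unfolding facts_def by blast
      ultimately show ?thesis using M' by blast
    qed
    ultimately show ?thesis unfolding viable_def by (auto intro!: all_hitI witnessedI)
  qed
  have misses: "\<not> hits T q m" if C: "cex vs lim d F" and "lay vs pl ins outs' d" "q \<in> set (pairs vs)"
      "length pl < dist d q" "dist d q \<noteq> t" "m \<in> F" for d F outs' q m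
    using far_misses[OF C facts[OF C lay_levs]] that t by blast
  have p_far: "length pl < dist d p" if "cex vs lim d F" "lay vs pl ins outs' d" for d F outs'
    using facts[OF that(1) lay_levs[OF that(2)]] p(1) unfolding facts_def by blast
  consider (skip) "p \<in> set skip" | (out) "p \<notin> set skip" "\<not> can_hit T p M"
    | (forced) k where "p \<notin> set skip" "can_hit T p M" "missing (Suc lim) (place t p un) = Suc k"
    | (split) "p \<notin> set skip" "can_hit T p M" "missing (Suc lim) (place t p un) = 0"
    by (meson not0_implies_Suc)
  then show ?case
  proof cases
    case skip
    then have "set und \<subseteq> set ins \<union> set outs \<union> set ps" using Cons.prems(6,7) by auto
    from Cons.IH[OF C L _ Cons.prems(4,5,6) this Cons.prems(8) inv] skip Cons.prems(3)
    show ?thesis by (simp add: elem_iff)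
  next
    case out
    have ne: "dist d p \<noteq> t" if CL: "cex vs lim d F" "lay vs pl ins outs d" for d F
    proof
      assume "dist d p = t"
      then obtain m where "m \<in> F" "hits T p m"
        using witness_hits[OF CL(1) p(2), of T "length pl"] facts[OF CL(1) lay_levs[OF CL(2)]] t unfolding facts_def by blast
      then show False using inv[OF CL] neutral p(1) can_hitI out(2) by blast
    qed
    have L': "lay vs pl ins (p # outs) d" using ne[OF C L] L t by (simp add: lay_def)
    have inv': "F \<subseteq> members M \<union> members ns \<and> caps vs t un d" if "cex vs lim d F" "lay vs pl ins (p # outs) d" for d F
      using inv[of d F] that by (simp add: lay_def)
    have "\<exists>nd\<in>set (layer (Suc lim) t T pl us und sy ns un (p # outs) skip ins M ps). good vs lim nd \<and> realised vs lim nd"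
      by (rule Cons.IH[OF C L' _ Cons.prems(4) _ _ _ Cons.prems(8) inv']) (use Cons.prems p in auto)
    then show ?thesis using out by (simp add: elem_iff)
  next
    case forced
    have ne: "dist d p \<noteq> t" if CL: "cex vs lim d F" "lay vs pl ins outs d" for d F
    proof
      assume e: "dist d p = t"
      obtain x y where xy: "p = (x, y)" by (cases p)
      then have "x \<noteq> y" using p(2) in_pairs before_neq by blast
      then have "caps vs t (place t p un) d" using caps_place[OF CL(1), of t un x y] inv[OF CL] e xy by (simp add: dist_def)
      then show False using caps_missing[OF CL(1)] Cons.prems(8) forced(3) by simp
    qed
    let ?M = "without T p M"
    have L': "lay vs pl ins (p # outs) d" using ne[OF C L] L t by (simp add: lay_def)
    have inv': "F \<subseteq> members ?M \<union> members ns \<and> caps vs t un d" if CL: "cex vs lim d F" "lay vs pl ins (p # outs) d" for d F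
    proof -
      have l: "lay vs pl ins outs d" using CL(2) by (simp add: lay_def)
      then show ?thesis using inv[OF CL(1) l] misses[OF CL(1) l p(2) p_far[OF CL(1) l] ne[OF CL(1) l]] members_without by blast
    qed
    have "viable T us ins ?M" using viable[OF C L'] inv'[OF C L'] by blast
    moreover have "\<exists>nd\<in>set (layer (Suc lim) t T pl us und sy ns un (p # outs) skip ins ?M ps). good vs lim nd \<and> realised vs lim nd"
      by (rule Cons.IH[OF C L' _ Cons.prems(4) _ _ _ Cons.prems(8) inv']) (use Cons.prems p in auto)
    ultimately show ?thesis using forced by (simp add: elem_iff)
  next
    case split
    let ?os = "orbit (symmetries outs (symmetries ins sy)) p"
    let ?In = "layer (Suc lim) t T pl us und sy ns (place t p un) outs skip (p # ins) M ps"
    let ?Out = "layer (Suc lim) t T pl us und sy ns un (join ?os outs) (join ?os skip) ins (withouts T ?os M) ps"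
    have "(\<exists>nd\<in>set ?In. good vs lim nd \<and> realised vs lim nd) \<or>
        (viable T us ins (withouts T ?os M) \<and> (\<exists>nd\<in>set ?Out. good vs lim nd \<and> realised vs lim nd))"
    proof (cases "\<exists>d F. cex vs lim d F \<and> lay vs pl (p # ins) outs d")
      case True
      then obtain d' F' where C': "cex vs lim d' F'" and L': "lay vs pl (p # ins) outs d'" by blast
      have inv': "F \<subseteq> members M \<union> members ns \<and> caps vs t (place t p un) d"
        if CL: "cex vs lim d F" "lay vs pl (p # ins) outs d" for d F
      proof -
        have l: "lay vs pl ins outs d" and e: "dist d p = t" using CL(2) t by (auto simp: lay_def)
        obtain x y where xy: "p = (x, y)" by (cases p)
        then have "x \<noteq> y" using p(2) in_pairs before_neq by blast
        then show ?thesis using caps_place[OF CL(1), of t un x y] inv[OF CL(1) l] e xy by (simp add: dist_def)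
      qed
      have "\<exists>nd\<in>set ?In. good vs lim nd \<and> realised vs lim nd"
        by (rule Cons.IH[OF C' L' _ _ Cons.prems(5,6) _ _ inv']) (use Cons.prems p in auto)
      then show ?thesis by blast
    next
      case False
      have os: "q \<in> set (pairs vs) \<and> dist d q \<noteq> t \<and> length pl < dist d q"
        if CL: "cex vs lim d F" "lay vs pl ins outs d" and q: "q \<in> set ?os" for d F q
      proof -
        obtain s where s: "sym_of vs lim (lay vs pl ins outs) s" "q \<in> set (pairs vs)"
            "dist d q = d (s (fst p)) (s (snd p))"
          using orbit_related[OF sh p(2) q] cex_sym[OF CL(1)] unfolding related_def by blast
        let ?d = "\<lambda>x y. d (s x) (s y)"
        obtain F' where CL': "cex vs lim ?d F'" "lay vs pl ins outs ?d" using s(1) CL unfolding sym_of_def by blast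
        have e: "dist ?d p = dist d q" using s(3) by (simp add: dist_def)
        have "dist ?d p \<noteq> t"
        proof
          assume "dist ?d p = t"
          then have "lay vs pl (p # ins) outs ?d" using CL'(2) t unfolding lay_def by simp
          then show False using False CL'(1) by blast
        qed
        then show ?thesis using e s(2) p_far[OF CL'] by simp
      qed
      let ?M = "withouts T ?os M"
      have L': "lay vs pl ins (join ?os outs) d" using os[OF C L] L t by (auto simp: lay_def join_append)
      have inv': "F \<subseteq> members ?M \<union> members ns \<and> caps vs t un d"
        if CL: "cex vs lim d F" "lay vs pl ins (join ?os outs) d" for d F
      proof -
        have l: "lay vs pl ins outs d" using CL(2) by (simp add: lay_def join_append)
        have "\<not> hits T q m" if "m \<in> F" "q \<in> set ?os" for q m
          using misses[OF CL(1) l] os[OF CL(1) l that(2)] that(1) by blast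
        then have "m \<in> members ?M" if "m \<in> F" "m \<in> members M" for m using that members_withouts by blast
        then show ?thesis using inv[OF CL(1) l] by blast
      qed
      have "viable T us ins ?M" using viable[OF C L'] inv'[OF C L'] by blast
      moreover have "\<exists>nd\<in>set ?Out. good vs lim nd \<and> realised vs lim nd"
        by (rule Cons.IH[OF C L' _ Cons.prems(4) _ _ _ Cons.prems(8) inv'])
          (use Cons.prems p os[OF C L] orbit_self[of p] in \<open>auto simp: join_append\<close>)
      ultimately show ?thesis by blast
    qed
    then show ?thesis using split by (auto simp: elem_iff join_append Let_def)
  qed
qed

text \<open>Two different states merged by a letter have distance one.\<close>
lemma generate_sound:
  assumes C: "cex vs lim d F" and T: "table_ok vs T (length pl) d" and F: "F \<subseteq> members M"
  shows "F \<subseteq> members (generate vs T (Suc (length pl)) M)"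
proof (cases "M = All \<and> length pl = Suc 0")
  case True
  have "m \<in> members (extend T vs vs [] base_map)" if m: "m \<in> F" for m
  proof (rule extend_complete)
    show "img x m \<in> set vs" if "x \<in> set vs" for x using cex_closed[OF C m that] .
    show "entry T x y" if xy: "x \<in> set vs" "y \<in> set vs" "x \<noteq> y" "img x m = img y m" for x y
    proof -
      have "d (img x m) (img y m) = 0" using cex_zero[OF C] cex_closed[OF C m] xy by simp
      then have "d x y \<le> Suc 0" using cex_step[OF C m xy(1,2)] by simp
      moreover have "d x y \<noteq> 0" using cex_zero[OF C xy(1,2)] xy(3) by simp
      ultimately show ?thesis using T True xy unfolding table_ok_def by simp
    qed
    show "img x base_map = img x m" if "x \<notin> set vs" for x
      using cex_padded[OF C m that] by (cases x) (simp_all add: base_map_def)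
  qed (use distinct_vs in auto)
  then show ?thesis using True by auto
next
  case False
  then have "generate vs T (Suc (length pl)) M = M"
    by (cases M; cases "length pl" rule: nat.exhaust; cases "length pl - 1") auto
  then show ?thesis using F by simp
qed

lemma children_sound:
  assumes g: "good vs lim (Node t T pl und M un sy)" and r: "realised vs lim (Node t T pl und M un sy)" and und: "und \<noteq> []"
  shows "\<exists>nd\<in>set (children lim vs (Node t T pl und M un sy)). good vs lim nd \<and> realised vs lim nd"
proof -
  let ?M = "generate vs T t M"
  have t: "t = Suc (length pl)" and sh: "shape vs pl und sy" and len: "Suc (length un) = card (set vs)"
    and inv: "\<And>d F. cex vs lim d F \<Longrightarrow> levs vs pl d \<Longrightarrow> facts vs pl T und d \<and> F \<subseteq> members M \<and> caps vs t un d"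
    using g by auto
  have gen: "F \<subseteq> members ?M" if "cex vs lim d F" "levs vs pl d" for d F
    using generate_sound[OF that(1), of T pl M] inv[OF that] t unfolding facts_def by simp
  obtain d F where C: "cex vs lim d F" and L: "levs vs pl d" using r by auto
  have w: "witnessed pl ?M"
  proof (rule witnessedI, intro ballI, clarify)
    fix ps U x y assume a: "(ps, U) \<in> set pl" "(x, y) \<in> set ps"
    then have "(x, y) \<in> set (pairs vs)" using sh unfolding shape_def by blast
    then show "\<exists>m\<in>members ?M. hits U (x, y) m"
      using levs_witness[OF C L _ a] inv[OF C L] gen[OF C L] unfolding facts_def by blast
  qed
  have "\<exists>nd\<in>set (layer (Suc lim) t T pl (unhits pl (neutral T und ?M)) und sy (neutral T und ?M) un [] [] [] (active T und ?M) und).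
      good vs lim nd \<and> realised vs lim nd"
  proof (rule layer_sound[OF sh t und _ _ _ C])
    show "facts vs pl T und d" if "cex vs lim d F" "levs vs pl d" for d F using inv[OF that] by blast
    show "\<not> hits T p m" if "m \<in> members (neutral T und ?M)" "p \<in> set und" for m p using neutral_misses that by blast
    show "\<exists>ps. (ps, T') \<in> set pl \<and> (\<forall>p\<in>set ps'. p \<in> set ps \<and> (\<forall>m\<in>members (neutral T und ?M). \<not> hits T' p m))"
      if "(ps', T') \<in> set (unhits pl (neutral T und ?M))" for ps' T'
      using unhitsD[OF that] can_hitI by blast
    show "lay vs pl [] [] d" using L by (simp add: lay_def)
    show "F \<subseteq> members (active T und ?M) \<union> members (neutral T und ?M) \<and> caps vs t un d"
      if "cex vs lim d F" "lay vs pl [] [] d" for d F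
      using inv[OF that(1)] gen[OF that(1)] members_active_neutral[of _ ?M T und] that(2) unfolding lay_def by blast
  qed (use len in auto)
  then show ?thesis using w by (simp add: layers_def)
qed
end

section \<open>Full layerings\<close>

lemma ex_state: "(\<exists>x. P x) \<longleftrightarrow> P S0 \<or> P S1 \<or> P S2 \<or> P S3 \<or> P S4 \<or> P S5"
  by (metis state.exhaust)

lemma all_state: "(\<forall>x. P x) \<longleftrightarrow> P S0 \<and> P S1 \<and> P S2 \<and> P S3 \<and> P S4 \<and> P S5"
  by (metis state.exhaust)

lemma bit_add_bit: "bit y (add_bit z x K) \<longleftrightarrow> z \<and> y = x \<or> bit y K"
  by (cases z) auto

lemma rset_image: "rset (image m K) = (\<lambda>x. img x m) ` rset K"
proof (rule set_eqI)
  fix y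
  have "y \<in> rset (image m K) \<longleftrightarrow> (\<exists>x. bit x K \<and> y = img x m)"
    unfolding ex_state by (cases m; cases K) (auto simp: rset_def bit_add_bit)
  then show "y \<in> rset (image m K) \<longleftrightarrow> y \<in> (\<lambda>x. img x m) ` rset K" by (auto simp: rset_def)
qed

lemma singletonD: "singleton K \<Longrightarrow> \<exists>s. rset K = {s}"
  by (cases K rule: singleton.cases) (simp_all add: rset_def set_eq_iff ex_state all_state)

lemma rset_full_row: "rset (full_row xs) = set xs"
  by (induction xs) (auto simp: rset_def)

lemma set_flatten: "(p, T) \<in> set (flatten pl acc) \<longleftrightarrow> (p, T) \<in> set acc \<or> (\<exists>ps. (ps, T) \<in> set pl \<and> p \<in> set ps)"
  by (induction pl acc rule: flatten.induct) (auto simp: join_append)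

lemma apply_first_Some: "apply_first T p K ms = Some K' \<Longrightarrow> \<exists>m\<in>set ms. K' = image m K"
  by (induction ms) (auto split: if_splits)

lemma greedy_step_Some: "greedy_step al ms K = Some K' \<Longrightarrow> \<exists>m\<in>set ms. K' = image m K"
  by (induction al) (auto split: if_splits dest: apply_first_Some)

lemma collapsible_image:
  "set ms \<subseteq> F \<Longrightarrow> m \<in> set ms \<Longrightarrow> collapsible F i (rset (image m K)) \<Longrightarrow> collapsible F (Suc i) (rset K)"
  by (auto simp: rset_image intro: collapsible_letter)

lemma collapsible_row: "singleton K \<Longrightarrow> collapsible F i (rset K)"
  using singletonD collapsible_singleton by blast

lemma greedy_sound: "greedy i al ms K \<Longrightarrow> set ms \<subseteq> F \<Longrightarrow> collapsible F i (rset K)"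
proof (induction i arbitrary: K)
  case (Suc i)
  show ?case
  proof (cases "singleton K")
    case False
    then obtain K' where K': "greedy_step al ms K = Some K'" "greedy i al ms K'"
      using Suc.prems(1) by (auto split: option.splits)
    then show ?thesis using greedy_step_Some[OF K'(1)] Suc.IH[OF K'(2) Suc.prems(2)] collapsible_image[OF Suc.prems(2)] by blast
  qed (rule collapsible_row)
qed (use collapsible_row in simp)

lemma successors_new:
  "K' \<in> set (fst (successors ms K new old)) \<Longrightarrow> K' \<in> set new \<or> (\<exists>m\<in>set ms. K' = image m K)"
proof (induction ms arbitrary: new old)
  case (Cons m ms)
  show ?case
  proof (cases "elem_row (image m K) old")
    case True
    then show ?thesis using Cons.IH[of new old] Cons.prems by auto
  next
    case False
    then show ?thesis using Cons.IH[of "image m K # new" "image m K # old"] Cons.prems by auto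
  qed
qed simp

lemma next_rows_new:
  "K' \<in> set (fst (next_rows ms Ks new old)) \<Longrightarrow> K' \<in> set new \<or> (\<exists>K\<in>set Ks. \<exists>m\<in>set ms. K' = image m K)"
proof (induction Ks arbitrary: new old)
  case (Cons K Ks)
  obtain new' old' where e: "successors ms K new old = (new', old')" by (cases "successors ms K new old")
  then show ?case using Cons.IH[of new' old'] Cons.prems successors_new[of K' ms K new old] by auto
qed simp

lemma any_singletonD: "any_singleton Ks \<Longrightarrow> \<exists>K\<in>set Ks. collapsible F i (rset K)"
  using collapsible_row by (induction Ks) (auto split: if_splits)

lemma breadth_sound: "breadth i ms Ks old \<Longrightarrow> set ms \<subseteq> F \<Longrightarrow> \<exists>K\<in>set Ks. collapsible F i (rset K)"
proof (induction i arbitrary: Ks old)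
  case 0
  then show ?case using any_singletonD by simp
next
  case (Suc i)
  show ?case
  proof (cases "any_singleton Ks")
    case False
    obtain new old' where e: "next_rows ms Ks [] old = (new, old')" by (cases "next_rows ms Ks [] old")
    then have "breadth i ms new old'" using Suc.prems(1) False by simp
    then obtain K' where K': "K' \<in> set new" "collapsible F i (rset K')" using Suc.IH Suc.prems(2) by blast
    then obtain K m where "K \<in> set Ks" "m \<in> set ms" "K' = image m K"
      using next_rows_new[of K' ms Ks "[]" old] e by auto
    then show ?thesis using collapsible_image[OF Suc.prems(2)] K'(2) by blast
  qed (rule any_singletonD)
qed

lemma set_map_hitting: "set (map_hitting T p ms) = {m \<in> set ms. hits T p m}" by (induction ms) auto

lemma candidates_complete: "known M \<Longrightarrow> m \<in> members M \<Longrightarrow> hits T p m \<Longrightarrow> m \<in> set (candidates T p M)"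
  by (induction M) (auto simp: set_map_hitting join_append split: if_splits)

text \<open>Every choice of witnesses from the pool is refuted, so is the one consisting of letters.\<close>
lemma assign_sound:
  assumes cand: "\<And>m T p. m \<in> F \<Longrightarrow> hits T p m \<Longrightarrow> m \<in> set (candidates T p M)"
  shows "assign l K al M r ms \<Longrightarrow> set ms \<subseteq> F \<Longrightarrow> \<forall>(p, T)\<in>set r. \<exists>m\<in>F. hits T p m \<Longrightarrow> collapsible F l (rset K)"
proof (induction r arbitrary: ms)
  case Nil
  then show ?case using greedy_sound breadth_sound[of l ms "[K]" "[K]" F] by (auto split: if_splits)
next
  case (Cons a r)
  obtain p T where a: "a = (p, T)" by (cases a)
  show ?case
  proof (cases "some_hit T p ms")
    case True
    then show ?thesis using Cons a by auto
  next
    case False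
    obtain m where m: "m \<in> F" "hits T p m" using Cons.prems(3) a by auto
    then have "assign l K al M r (m # ms)" using Cons.prems(1) False a cand by (auto simp: list_all_iff)
    then show ?thesis using Cons.IH[of "m # ms"] Cons.prems m by auto
  qed
qed

context search_space
begin

text \<open>A successful search refutes every counterexample with the levels of the node.\<close>
lemma search_sound: "search lim vs i nd \<Longrightarrow> good vs lim nd \<Longrightarrow> realised vs lim nd \<Longrightarrow> False"
proof (induction i arbitrary: nd)
  case (Suc i)
  obtain t T pl und M un sy where nd: "nd = Node t T pl und M un sy" by (cases nd)
  show ?case
  proof (cases und)
    case Nil
    have k: "known M" and a: "assign lim (full_row vs) (flatten pl []) M (flatten pl []) []"
      using Suc.prems(1) nd Nil by (auto split: if_splits)
    obtain d F where C: "cex vs lim d F" and L: "levs vs pl d" using Suc.prems(3) nd by auto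
    have inv: "tabs vs pl d" "F \<subseteq> members M" and sh: "shape vs pl und sy" using Suc.prems(2) nd C L by (auto simp: facts_def)
    have "collapsible F lim (rset (full_row vs))"
    proof (rule assign_sound[OF _ a])
      show "m \<in> set (candidates T p M)" if "m \<in> F" "hits T p m" for m T p
        using candidates_complete[OF k] that inv(2) by blast
      show "\<forall>(p, T)\<in>set (flatten pl []). \<exists>m\<in>F. hits T p m"
      proof clarify
        fix x y U assume "((x, y), U) \<in> set (flatten pl [])"
        then obtain ps where ps: "(ps, U) \<in> set pl" "(x, y) \<in> set ps" by (auto simp: set_flatten)
        then have "(x, y) \<in> set (pairs vs)" using sh unfolding shape_def by blast
        then show "\<exists>m\<in>F. hits U (x, y) m" using levs_witness[OF C L inv(1) ps] by blast
      qed
    qed simp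
    then show ?thesis using cex_not_collapsible[OF C] by (simp add: rset_full_row)
  next
    case (Cons p ps)
    then obtain nd' where "nd' \<in> set (children lim vs nd)" "good vs lim nd'" "realised vs lim nd'"
      using children_sound Suc.prems(2,3) nd by blast
    then show ?thesis using Suc.IH Suc.prems(1) nd Cons by (auto simp: list_all_iff)
  qed
qed simp

lemma root_sound:
  assumes C: "cex vs lim d F" and ks: "\<forall>i<length ks. ks ! i = Suc (Suc i)" and len: "Suc (length ks) = length vs"
  shows "good vs lim (root ks vs)" "realised vs lim (root ks vs)"
proof -
  show "realised vs lim (root ks vs)" using C by (auto simp: root_def)
  have "facts vs [] diagonal (pairs vs) d" if C: "cex vs lim d F" for d F
  proof -
    have "0 < dist d p" if p: "p \<in> set (pairs vs)" for p
    proof -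
      obtain x y where xy: "p = (x, y)" by (cases p)
      then have "x \<in> set vs" "y \<in> set vs" "x \<noteq> y" using p in_pairs before_neq by auto
      then have "d x y \<noteq> 0" using cex_zero[OF C] by simp
      then show ?thesis using xy by (simp add: dist_def)
    qed
    then show ?thesis using cex_zero[OF C] by (auto simp: facts_def table_ok_def entry_diagonal)
  qed
  moreover have "caps vs (Suc 0) (List.map (\<lambda>k. capped 0 (subsets k vs)) ks) d" if C: "cex vs lim d F" for d F
    using caps_root[OF C distinct_vs ks] caps_mono by (meson le_SucI order_refl)
  moreover have "shape vs [] (pairs vs) (pairs vs)" by (auto simp: shape_def in_pairs)
  ultimately show "good vs lim (root ks vs)"
    using len distinct_vs by (auto simp: root_def distinct_card)
qed
end

section \<open>From automata to distance functions\<close>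

lemma run_Nil [simp]: "run \<delta> q [] = q" by (simp add: run_def)

lemma run_Cons [simp]: "run \<delta> q (a # w) = run \<delta> (\<delta> q a) w" by (simp add: run_def)

text \<open>The states are named by labels through a bijection. Appending a letter in front of a shortest merging word for the images
  merges the pair itself, so a letter lowers \<open>d\<close> by at most one; the first letter of a shortest merging word lowers it by exactly
  one.\<close>
lemma automaton_cex:
  assumes A: "synchronizing_dfa \<Sigma> Q \<delta>" and card: "card Q = card (set vs)"
    and long: "\<And>w. synchronizing_word \<Sigma> Q \<delta> w \<Longrightarrow> lim < length w"
  shows "\<exists>d F. cex vs lim d F"
proof -
  interpret dfa \<Sigma> Q \<delta> using A unfolding synchronizing_dfa_def by blast
  obtain w0 where w0: "synchronizing_word \<Sigma> Q \<delta> w0" using A unfolding synchronizing_dfa_def by blast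
  obtain h where h: "bij_betw h (set vs) Q"
    using finite_same_card_bij[OF _ finite_states] card by force
  define g where "g = inv_into (set vs) h"
  have hg: "h (g q) = q" "g q \<in> set vs" if "q \<in> Q" for q
    using h that by (auto simp: g_def bij_betw_def f_inv_into_f inv_into_into)
  have hQ: "h x \<in> Q" if "x \<in> set vs" for x using h that by (auto simp: bij_betw_def)
  have h_eq: "h x = h y \<longleftrightarrow> x = y" if "x \<in> set vs" "y \<in> set vs" for x y
    using h that by (auto simp: bij_betw_def dest: inj_onD)
  define tr where "tr a = trans_of (\<lambda>x. if x \<in> set vs then g (\<delta> (h x) a) else S0)" for a
  have tr: "h (img x (tr a)) = \<delta> (h x) a" "img x (tr a) \<in> set vs" if "x \<in> set vs" "a \<in> \<Sigma>" for x a
    using that hg[OF step_closed[OF hQ[OF that(1)] that(2)]] by (auto simp: tr_def)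
  define P where "P x y l \<longleftrightarrow> (\<exists>w. w \<in> lists \<Sigma> \<and> length w = l \<and> run \<delta> (h x) w = run \<delta> (h y) w)" for x y l
  define d where "d x y = (LEAST l. P x y l)" for x y
  have P0: "P x y (length w0)" if "x \<in> set vs" "y \<in> set vs" for x y
    using w0 hQ[OF that(1)] hQ[OF that(2)] unfolding P_def synchronizing_word_def by metis
  have Pd: "P x y (d x y)" if "x \<in> set vs" "y \<in> set vs" for x y
    unfolding d_def using P0[OF that] by (rule LeastI)
  have d_le: "d x y \<le> l" if "P x y l" for x y l unfolding d_def using that by (rule Least_le)
  have step: "d x y \<le> Suc (d (img x (tr a)) (img y (tr a)))" if xya: "x \<in> set vs" "y \<in> set vs" "a \<in> \<Sigma>" for x y a
  proof -
    obtain w where "w \<in> lists \<Sigma>" "length w = d (img x (tr a)) (img y (tr a))"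
        "run \<delta> (h (img x (tr a))) w = run \<delta> (h (img y (tr a))) w"
      using Pd[OF tr(2)[OF xya(1,3)] tr(2)[OF xya(2,3)]] unfolding P_def by blast
    then have "P x y (Suc (d (img x (tr a)) (img y (tr a))))"
      unfolding P_def using tr xya by (intro exI[of _ "a # w"]) auto
    then show ?thesis by (rule d_le)
  qed
  have wit: "\<exists>a\<in>\<Sigma>. d x y = Suc (d (img x (tr a)) (img y (tr a)))" if xy: "x \<in> set vs" "y \<in> set vs" "x \<noteq> y" for x y
  proof -
    obtain w where w: "w \<in> lists \<Sigma>" "length w = d x y" "run \<delta> (h x) w = run \<delta> (h y) w"
      using Pd[OF xy(1,2)] unfolding P_def by blast
    then obtain a v where v: "w = a # v" using xy h_eq by (cases w) auto
    then have a: "a \<in> \<Sigma>" using w(1) by auto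
    have "P (img x (tr a)) (img y (tr a)) (length v)"
      unfolding P_def using w v tr xy a by (intro exI[of _ v]) auto
    then have "Suc (d (img x (tr a)) (img y (tr a))) \<le> d x y" using d_le w(2) v by fastforce
    then show ?thesis using step[OF xy(1,2) a] a by (meson le_antisym)
  qed
  have zero: "d x y = 0 \<longleftrightarrow> x = y" if "x \<in> set vs" "y \<in> set vs" for x y
  proof
    assume "d x y = 0"
    then have "P x y 0" using Pd[OF that] by simp
    then show "x = y" using h_eq[OF that] by (simp add: P_def)
  next
    assume "x = y"
    then have "P x y 0" by (simp add: P_def)
    then show "d x y = 0" using d_le by blast
  qed
  have word: "h (act (List.map tr u) x) = run \<delta> (h x) u" if "u \<in> lists \<Sigma>" "x \<in> set vs" for u x
    using that by (induction u arbitrary: x) (auto simp: tr)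
  have "\<not> collapsible (tr ` \<Sigma>) lim (set vs)"
  proof
    assume "collapsible (tr ` \<Sigma>) lim (set vs)"
    then obtain w s where w: "set w \<subseteq> tr ` \<Sigma>" "length w \<le> lim" "act w ` set vs = {s}"
      unfolding collapsible_def by blast
    then have "w \<in> lists (tr ` \<Sigma>)" by auto
    then obtain u where u: "w = List.map tr u" "u \<in> lists \<Sigma>" unfolding lists_image by auto
    have *: "run \<delta> q u = h s" if "q \<in> Q" for q
    proof -
      have "act w (g q) = s" using w(3) hg(2)[OF that] by blast
      then show ?thesis using word[OF u(2) hg(2)[OF that]] u(1) hg(1)[OF that] by simp
    qed
    have "set vs \<noteq> {}" using w(3) by auto
    then obtain q where q: "q \<in> Q" using hQ by (metis ex_in_conv)
    have "run \<delta> q' v \<in> Q" if "v \<in> lists \<Sigma>" "q' \<in> Q" for v q'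
      using that by (induction v arbitrary: q') (auto simp: step_closed)
    then have "h s \<in> Q" using *[OF q] u(2) q by metis
    then have "synchronizing_word \<Sigma> Q \<delta> u" using * u(2) unfolding synchronizing_word_def by blast
    then show False using long u(1) w(2) by fastforce
  qed
  moreover have "d x y = d y x" for x y unfolding d_def P_def by (metis)
  ultimately have "cex vs lim d (tr ` \<Sigma>)"
    unfolding cex_def using zero tr(2) step wit by (auto simp: tr_def)
  then show ?thesis by blast
qed

section \<open>The searches for two to six states\<close>

fun sizes :: "nat \<Rightarrow> state list \<Rightarrow> nat list" where
  "sizes k [] = []"
| "sizes k (x # xs) = k # sizes (Suc k) xs"

definition start :: "state list \<Rightarrow> node" where
  "start vs = root (sizes (Suc (Suc 0)) (tl vs)) vs"

text \<open>One level of the search. A node with a full layering is kept, for it must still be refuted.\<close>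
fun expand :: "nat \<Rightarrow> state list \<Rightarrow> node \<Rightarrow> node list" where
  "expand l vs (Node t T pl [] M un sy) = [Node t T pl [] M un sy]"
| "expand l vs (Node t T pl (p # ps) M un sy) = children l vs (Node t T pl (p # ps) M un sy)"

fun expand_all :: "nat \<Rightarrow> state list \<Rightarrow> node list \<Rightarrow> node list" where
  "expand_all l vs [] = []"
| "expand_all l vs (nd # nds) = join (expand l vs nd) (expand_all l vs nds)"

text \<open>Halving the list of nodes twice in this way gives four parts, which are refuted independently of each
  other.\<close>
fun evens :: "'a list \<Rightarrow> 'a list" and odds :: "'a list \<Rightarrow> 'a list" where
  "evens [] = []"
| "evens (x # xs) = x # odds xs"
| "odds [] = []"
| "odds (x # xs) = evens xs"

lemma set_evens_odds: "set (evens xs) \<union> set (odds xs) = set xs"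
  by (induction xs) auto

lemma length_sizes: "length (sizes k xs) = length xs" by (induction xs arbitrary: k) simp_all

lemma sizes_nth: "i < length xs \<Longrightarrow> sizes k xs ! i = k + i"
  by (induction xs arbitrary: k i) (auto simp: nth_Cons split: nat.split)

lemma set_expand_all: "set (expand_all l vs nds) = (\<Union>nd\<in>set nds. set (expand l vs nd))"
  by (induction nds) (auto simp: join_append)

context search_space
begin

lemma start_sound:
  assumes "cex vs lim d F" and "vs \<noteq> []"
  shows "good vs lim (start vs)" "realised vs lim (start vs)"
  using root_sound[OF assms(1), of "sizes (Suc (Suc 0)) (tl vs)"] assms(2)
  by (simp_all add: start_def length_sizes sizes_nth)

lemma search_refutes: "search lim vs i (start vs) \<Longrightarrow> vs \<noteq> [] \<Longrightarrow> \<not> cex vs lim d F"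
  using start_sound search_sound by blast

lemma expand_sound:
  assumes "good vs lim nd" "realised vs lim nd"
  shows "\<exists>nd'\<in>set (expand lim vs nd). good vs lim nd' \<and> realised vs lim nd'"
proof -
  obtain t T pl und M un sy where nd: "nd = Node t T pl und M un sy" by (cases nd)
  show ?thesis
  proof (cases und)
    case Nil
    then have "expand lim vs nd = [nd]" using nd by simp
    then show ?thesis using assms by simp
  next
    case (Cons p ps)
    then have e: "expand lim vs nd = children lim vs (Node t T pl und M un sy)"
      using nd by (simp only: expand.simps)
    have ne: "und \<noteq> []" using Cons by simp
    show ?thesis unfolding e by (rule children_sound[OF assms[unfolded nd] ne])
  qed
qed
end

definition two where "two = [S0, S1]"

definition three where "three = [S0, S1, S2]"

definition four where "four = [S0, S1, S2, S3]"

definition five where "five = [S0, S1, S2, S3, S4]"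

definition six where "six = [S0, S1, S2, S3, S4, S5]"

definition six_nodes where "six_nodes = expand_all 25 six (expand 25 six (start six))"

lemma search_two: "search 1 two 20 (start two)" by code_simp

lemma search_three: "search 4 three 20 (start three)" by code_simp

lemma search_four: "search 9 four 20 (start four)" by code_simp

lemma search_five: "search 16 five 20 (start five)" by code_simp

lemma search_six_0: "search_all 25 six 20 (evens (evens six_nodes))" by code_simp

lemma search_six_1: "search_all 25 six 20 (evens (odds six_nodes))" by code_simp

lemma search_six_2: "search_all 25 six 20 (odds (evens six_nodes))" by code_simp

lemma search_six_3: "search_all 25 six 20 (odds (odds six_nodes))" by code_simp

lemma search_spaces: "search_space two" "search_space three" "search_space four" "search_space five" "search_space six"
  by (unfold_locales; simp add: set_eq_iff split_paired_All all_state two_def three_def four_def five_def six_def)+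

lemma no_cex_six: "\<not> cex six 25 d F"
proof
  assume C: "cex six 25 d F"
  interpret search_space six 25 by (rule search_spaces)
  have "six \<noteq> []" by (simp add: six_def)
  then obtain nd where "nd \<in> set (expand 25 six (start six))" "good six 25 nd" "realised six 25 nd"
    using expand_sound start_sound[OF C] by blast
  then obtain nd' where nd': "nd' \<in> set six_nodes" "good six 25 nd'" "realised six 25 nd'"
    using expand_sound unfolding six_nodes_def set_expand_all by blast
  moreover have "search 25 six 20 nd'"
    using nd'(1) search_six_0 search_six_1 search_six_2 search_six_3 set_evens_odds[of six_nodes]
      set_evens_odds[of "evens six_nodes"] set_evens_odds[of "odds six_nodes"]
    unfolding search_all_def list_all_iff by blast
  ultimately show False using search_sound by blast
qed

theorem theorem1:
  fixes n :: nat and \<Sigma> :: "'a set" and Q :: "'q set" and \<delta> :: "'q \<Rightarrow> 'a \<Rightarrow> 'q"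
  assumes "n > 0" and "n \<le> 6"
    and "synchronizing_dfa \<Sigma> Q \<delta>" and "card Q = n"
  shows "\<exists>w. synchronizing_word \<Sigma> Q \<delta> w \<and> length w \<le> (n - 1)\<^sup>2"
proof (cases "n = 1")
  case True
  then obtain q where "Q = {q}" using assms(4) card_1_singletonE by blast
  then have "synchronizing_word \<Sigma> Q \<delta> []" by (simp add: synchronizing_word_def)
  then show ?thesis by auto
next
  case False
  have "\<exists>vs. card (set vs) = n \<and> (\<forall>d F. \<not> cex vs ((n - 1)\<^sup>2) d F)"
  proof -
    consider "n = 2" | "n = 3" | "n = 4" | "n = 5" | "n = 6" using assms(1,2) False by linarith
    then show ?thesis
    proof cases
      case 1
      then show ?thesis using search_space.search_refutes[OF search_spaces(1) search_two]
        by (intro exI[of _ two]) (simp add: two_def)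
    next
      case 2
      then show ?thesis using search_space.search_refutes[OF search_spaces(2) search_three]
        by (intro exI[of _ three]) (simp add: three_def)
    next
      case 3
      then show ?thesis using search_space.search_refutes[OF search_spaces(3) search_four]
        by (intro exI[of _ four]) (simp add: four_def)
    next
      case 4
      then show ?thesis using search_space.search_refutes[OF search_spaces(4) search_five]
        by (intro exI[of _ five]) (simp add: five_def)
    next
      case 5
      then show ?thesis using no_cex_six by (intro exI[of _ six]) (simp add: six_def)
    qed
  qed
  then obtain vs where vs: "card (set vs) = n" "\<And>d F. \<not> cex vs ((n - 1)\<^sup>2) d F" by blast
  show ?thesis
  proof (rule ccontr)
    assume "\<not> ?thesis"
    then have "(n - 1)\<^sup>2 < length w" if "synchronizing_word \<Sigma> Q \<delta> w" for w using that by (meson not_le)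
    then show False using automaton_cex[OF assms(3), of vs] assms(4) vs by metis
  qed
qed

end
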